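(* Let $\{X_n\}_{n\in\mathbb{N}}$ be a sequence of finite metric spaces of uniformly bounded geometry with $|X_n|\to\infty$. Let $X$ be their coarse disjoint union, and let $P_X$ be the averaging projection of $X$. Then the following are equivalent: (1) $P_X$ belongs to the uniform Roe algebra $C^*_u(X)$; (2) $P_X$ belongs to the uniform quasi-local algebra $C^*_{uq}(X)$; (3) $\{X_n\}_{n\in\mathbb{N}}$ is a sequence of asymptotic expanders.
   Context: For a metric space $(X,d)$, $A\subseteq X$ and $R>0$, let $\partial_R A=\{x\in X\setminus A : d(x,A)\le R\}$. A sequence $\{X_n\}_{n\in\mathbb{N}}$ of finite metric spaces with $|X_n|\to\infty$ is a sequence of asymptotic expanders if for every $\alpha\in(0,\frac12]$ there exist $c_\alpha\in(0,1)$ and $R_\alpha>0$ such that for every $n$ and every $A\subseteq X_n$ with $\alpha|X_n|\le|A|\le\frac12|X_n|$ we have $|\partial_{R_\alpha}A|>c_\alpha|A|$. The sequence has uniformly bounded geometry if for every $R>0$, $\sup_n\sup_{x\in X_n}|B(x,R)|<\infty$ (closed balls in $X_n$). A coarse disjoint union of finite metric spaces $\{(X_n,d_n)\}$ is the set $X=\bigsqcup_n X_n$ with a metric $d$ that restricts to $d_n$ on each $X_n$ and satisfies $d(X_n,X_m)\ge n+m+\mathrm{diam}(X_n)+\mathrm{diam}(X_m)$ for $n\ne m$. View operators $T$ on $\ell^2(X)$ as matrices $[T_{x,y}]_{x,y\in X}$. $T$ has finite propagation if there is $R>0$ with $T_{x,y}=0$ whenever $d(x,y)>R$. The uniform Roe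 algebra $C^*_u(X)$ is the operator-norm closure in the bounded operators on $\ell^2(X)$ of the $*$-algebra of bounded finite propagation operators. A bounded operator $T$ on $\ell^2(X)$ is quasi-local if for every $\varepsilon>0$ there is $R>0$ such that $\|\chi_AT\chi_B\|\le\varepsilon$ for all $A,B\subseteq X$ with $d(A,B)\ge R$ (where $\chi_A$ acts by multiplication). The uniform quasi-local algebra $C^*_{uq}(X)$ is the $C^*$-algebra of all quasi-local operators on $\ell^2(X)$. The averaging projection of $X$ is $P_X=\bigoplus_nP_{X_n}$ on $\ell^2(X)=\bigoplus_n\ell^2(X_n)$, where $P_{X_n}$ is the orthogonal projection of $\ell^2(X_n)$ onto the constant functions, i.e. all its matrix entries equal $1/|X_n|$. *)

theory Defs
  imports "HOL-Analysis.Analysis"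
begin

section \<open>Metric notions\<close>

text \<open>
  Metric spaces are given by a carrier and a distance function, as in the library locale
  \<open>Metric_space\<close>. Distances to sets are taken in \<open>ereal\<close>, so that
  the distance to the empty set is infinite.
\<close>

definition set_distance :: "('a \<Rightarrow> 'a \<Rightarrow> real) \<Rightarrow> 'a set \<Rightarrow> 'a set \<Rightarrow> ereal" where
  "set_distance d A B = (INF a\<in>A. INF b\<in>B. ereal (d a b))"

definition diam :: "'a set \<Rightarrow> ('a \<Rightarrow> 'a \<Rightarrow> real) \<Rightarrow> real" where
  "diam M d = (SUP (x, y)\<in>M \<times> M. d x y)"

definition outer_boundary ::
  "'a set \<Rightarrow> ('a \<Rightarrow> 'a \<Rightarrow> real) \<Rightarrow> real \<Rightarrow> 'a set \<Rightarrow> 'a set" where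
  "outer_boundary M d R A = {x \<in> M - A. set_distance d {x} A \<le> ereal R}"

definition asymptotic_expanders ::
  "(nat \<Rightarrow> 'a set) \<Rightarrow> (nat \<Rightarrow> 'a \<Rightarrow> 'a \<Rightarrow> real) \<Rightarrow> bool" where
  "asymptotic_expanders M d \<longleftrightarrow>
     (\<forall>n. Metric_space (M n) (d n) \<and> finite (M n)) \<and>
     filterlim (\<lambda>n. card (M n)) at_top sequentially \<and>
     (\<forall>\<alpha>::real. 0 < \<alpha> \<and> \<alpha> \<le> 1/2 \<longrightarrow>
       (\<exists>c R::real. 0 < c \<and> c < 1 \<and> 0 < R \<and>
         (\<forall>n. \<forall>A. A \<subseteq> M n \<and> \<alpha> * real (card (M n)) \<le> real (card A)
              \<and> real (card A) \<le> 1/2 * real (card (M n)) \<longrightarrow>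
            real (card (outer_boundary (M n) (d n) R A)) > c * real (card A))))"

definition uniformly_bounded_geometry ::
  "(nat \<Rightarrow> 'a set) \<Rightarrow> (nat \<Rightarrow> 'a \<Rightarrow> 'a \<Rightarrow> real) \<Rightarrow> bool" where
  "uniformly_bounded_geometry M d \<longleftrightarrow>
     (\<forall>R>0. \<exists>N::nat. \<forall>n. \<forall>x\<in>M n.
        finite (Metric_space.mcball (M n) (d n) x R) \<and>
        card (Metric_space.mcball (M n) (d n) x R) \<le> N)"

text \<open>
  The disjoint union of the \<open>M n\<close> is \<open>Sigma UNIV M\<close>, with \<open>M n\<close>
  embedded as \<open>{n} \<times> M n\<close>. The metric on it is not determined by the
  conditions, so this is a predicate on \<open>D\<close>.
\<close>

definition coarse_disjoint_union ::
  "(nat \<Rightarrow> 'a set) \<Rightarrow> (nat \<Rightarrow> 'a \<Rightarrow> 'a \<Rightarrow> real)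
     \<Rightarrow> (nat \<times> 'a \<Rightarrow> nat \<times> 'a \<Rightarrow> real) \<Rightarrow> bool" where
  "coarse_disjoint_union M d D \<longleftrightarrow>
     Metric_space (Sigma UNIV M) D \<and>
     (\<forall>n. \<forall>x\<in>M n. \<forall>y\<in>M n. D (n, x) (n, y) = d n x y) \<and>
     (\<forall>n m. n \<noteq> m \<longrightarrow>
        set_distance D ({n} \<times> M n) ({m} \<times> M m)
          \<ge> ereal (real n + real m + diam (M n) (d n) + diam (M m) (d m)))"

section \<open>Bounded operators on square-summable functions\<close>

text \<open>
  Elements of \<open>ell2 X\<close> are functions on the whole type that vanish outside \<open>X\<close>,
  and operators are required to be \<open>undefined\<close> outside \<open>ell2 X\<close>
  (\<open>\<rightarrow>\<^sub>E\<close>), so that equality of vectors and of operators is equality in HOL.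
\<close>

definition ell2 :: "'x set \<Rightarrow> ('x \<Rightarrow> complex) set" where
  "ell2 X = {f. (\<forall>x. x \<notin> X \<longrightarrow> f x = 0) \<and> (\<lambda>x. (cmod (f x))\<^sup>2) summable_on X}"

definition ell2_norm :: "'x set \<Rightarrow> ('x \<Rightarrow> complex) \<Rightarrow> real" where
  "ell2_norm X f = sqrt (\<Sum>\<^sub>\<infinity>x\<in>X. (cmod (f x))\<^sup>2)"

definition bounded_ops :: "'x set \<Rightarrow> (('x \<Rightarrow> complex) \<Rightarrow> ('x \<Rightarrow> complex)) set" where
  "bounded_ops X = {T \<in> ell2 X \<rightarrow>\<^sub>E ell2 X.
     (\<forall>f\<in>ell2 X. \<forall>g\<in>ell2 X. T (\<lambda>x. f x + g x) = (\<lambda>x. T f x + T g x)) \<and>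
     (\<forall>c. \<forall>f\<in>ell2 X. T (\<lambda>x. c * f x) = (\<lambda>x. c * T f x)) \<and>
     (\<exists>C::real. \<forall>f\<in>ell2 X. ell2_norm X (T f) \<le> C * ell2_norm X f)}"

text \<open>Only meaningful for bounded operators; the values outside \<open>ell2 X\<close> play no role.\<close>

definition op_norm :: "'x set \<Rightarrow> (('x \<Rightarrow> complex) \<Rightarrow> ('x \<Rightarrow> complex)) \<Rightarrow> real" where
  "op_norm X T = (SUP f\<in>{f \<in> ell2 X. ell2_norm X f \<le> 1}. ell2_norm X (T f))"

definition delta :: "'x \<Rightarrow> 'x \<Rightarrow> complex" where
  "delta y = (\<lambda>x. if x = y then 1 else 0)"

definition matrix_entry :: "(('x \<Rightarrow> complex) \<Rightarrow> ('x \<Rightarrow> complex)) \<Rightarrow> 'x \<Rightarrow> 'x \<Rightarrow> complex" where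
  "matrix_entry T x y = T (delta y) x"

definition chi :: "'x set \<Rightarrow> ('x \<Rightarrow> complex) \<Rightarrow> ('x \<Rightarrow> complex)" where
  "chi A f = (\<lambda>x. if x \<in> A then f x else 0)"

section \<open>Uniform Roe algebra and uniform quasi-local algebra\<close>

definition finite_propagation ::
  "'x set \<Rightarrow> ('x \<Rightarrow> 'x \<Rightarrow> real) \<Rightarrow> (('x \<Rightarrow> complex) \<Rightarrow> ('x \<Rightarrow> complex)) \<Rightarrow> bool" where
  "finite_propagation X D T \<longleftrightarrow>
     (\<exists>R>0. \<forall>x\<in>X. \<forall>y\<in>X. D x y > R \<longrightarrow> matrix_entry T x y = 0)"

definition uniform_Roe_algebra ::
  "'x set \<Rightarrow> ('x \<Rightarrow> 'x \<Rightarrow> real) \<Rightarrow> (('x \<Rightarrow> complex) \<Rightarrow> ('x \<Rightarrow> complex)) set" where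
  "uniform_Roe_algebra X D = {T \<in> bounded_ops X.
     \<forall>\<epsilon>>0. \<exists>S\<in>bounded_ops X. finite_propagation X D S \<and>
       op_norm X (\<lambda>f x. T f x - S f x) < \<epsilon>}"

definition quasi_local ::
  "'x set \<Rightarrow> ('x \<Rightarrow> 'x \<Rightarrow> real) \<Rightarrow> (('x \<Rightarrow> complex) \<Rightarrow> ('x \<Rightarrow> complex)) \<Rightarrow> bool" where
  "quasi_local X D T \<longleftrightarrow>
     (\<forall>\<epsilon>>0. \<exists>R>0. \<forall>A B. A \<subseteq> X \<and> B \<subseteq> X \<and> set_distance D A B \<ge> ereal R \<longrightarrow>
        op_norm X (\<lambda>f. chi A (T (chi B f))) \<le> \<epsilon>)"

definition uniform_quasi_local_algebra ::
  "'x set \<Rightarrow> ('x \<Rightarrow> 'x \<Rightarrow> real) \<Rightarrow> (('x \<Rightarrow> complex) \<Rightarrow> ('x \<Rightarrow> complex)) set" where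
  "uniform_quasi_local_algebra X D = {T \<in> bounded_ops X. quasi_local X D T}"

section \<open>The averaging projection\<close>

text \<open>
  On the block \<open>{n} \<times> M n\<close> a function is replaced by its mean over that block.
\<close>

definition averaging_projection ::
  "(nat \<Rightarrow> 'a set) \<Rightarrow> (nat \<times> 'a \<Rightarrow> complex) \<Rightarrow> (nat \<times> 'a \<Rightarrow> complex)" where
  "averaging_projection M =
     restrict (\<lambda>f (n, x). if x \<in> M n then (\<Sum>y\<in>M n. f (n, y)) / of_nat (card (M n)) else 0)
       (ell2 (Sigma UNIV M))"

lemma delta_in_ell2: "y \<in> X \<Longrightarrow> delta y \<in> ell2 X"
proof -
  assume y: "y \<in> X"
  have "(\<lambda>x. (cmod (delta y x))\<^sup>2) summable_on {y}"
    by simp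
  then have "(\<lambda>x. (cmod (delta y x))\<^sup>2) summable_on X"
    by (rule summable_on_cong_neutral[THEN iffD1, rotated -1]) (use y in \<open>auto simp: delta_def\<close>)
  then show ?thesis
    using y by (auto simp: ell2_def delta_def)
qed

lemma matrix_entry_averaging_projection:
  assumes "\<And>n. finite (M n)" "x \<in> M n" "y \<in> M m"
  shows "matrix_entry (averaging_projection M) (n, x) (m, y)
           = (if n = m then 1 / of_nat (card (M n)) else 0)"
proof -
  have "delta (m, y) \<in> ell2 (Sigma UNIV M)"
    using assms by (intro delta_in_ell2) auto
  then show ?thesis
    using assms by (auto simp: matrix_entry_def averaging_projection_def delta_def)
qed

end

(*
  Quasi-locality of P and a set A with small boundary are incompatible, since P sees the points of
  the block far from A with a matrix coefficient of constant size. Conversely, removing from each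
  block a largest badly expanding set, of proportion at most alpha, leaves a genuine expander with
  constants independent of the block. By Cheeger's inequality the powers of the lazy random walk on
  it converge to its averaging projection uniformly in n; they have finite propagation, and this
  averaging projection is within O(sqrt alpha) of the one of the whole block.
*)
theory Submission
  imports Defs
begin

section \<open>Cheeger's inequality for weighted graphs\<close>

text \<open>Asymptotic expansion says nothing about sets of proportion below \<alpha>, so a block
  itself need not have a spectral gap: a few badly attached points can destroy it. This forces the
  passage to a subset, and the approximation can only be as good as the removed proportion is small;
  hence \<alpha> is chosen from the accuracy \<epsilon>, before the constants c and R of the
  expander condition are obtained. The second obstacle is uniformity: one power of the walk has to
  serve all blocks, since otherwise the propagation is unbounded. Bounded geometry provides a common
  degree bound \<open>K\<close>, and the contraction rate depends on \<open>K\<close> and the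
  expansion constant alone. Dividing by \<open>2 * K\<close> instead of the actual degree of a
  vertex keeps the walk symmetric, so that its limit is the plain mean and not a mean weighted by
  degrees.\<close>

locale weighted_graph =
  fixes Y :: "'a set" and w :: "'a \<Rightarrow> 'a \<Rightarrow> real" and K :: real
  assumes finite_Y: "finite Y"
    and w_nonneg: "\<And>x y. 0 \<le> w x y"
    and w_sym: "\<And>x y. x \<in> Y \<Longrightarrow> y \<in> Y \<Longrightarrow> w x y = w y x"
    and degree_le: "\<And>x. x \<in> Y \<Longrightarrow> (\<Sum>y\<in>Y. w x y) \<le> K"
    and K_ge_1: "1 \<le> K"
begin

lemma sum_swap_sym:
  "(\<Sum>x\<in>Y. \<Sum>y\<in>Y. w x y * F y x) = (\<Sum>x\<in>Y. \<Sum>y\<in>Y. w x y * F x y)"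
  by (subst sum.swap) (intro sum.cong refl, simp add: w_sym)

lemma degree_sum_le:
  assumes "\<And>x. x \<in> Y \<Longrightarrow> 0 \<le> u x"
  shows "(\<Sum>x\<in>Y. \<Sum>y\<in>Y. w x y * u x) \<le> K * (\<Sum>x\<in>Y. u x)"
proof -
  have "(\<Sum>y\<in>Y. w x y * u x) \<le> K * u x" if "x \<in> Y" for x
    using mult_right_mono[OF degree_le[OF that] assms[OF that]] by (simp add: sum_distrib_right)
  then show ?thesis
    by (simp add: sum_distrib_left sum_mono)
qed

end

text \<open>Expansion is measured by the weight of the edges leaving \<open>B\<close>, the form in
  which the layer-cake sum produces it.\<close>

locale expander_graph = weighted_graph +
  fixes c :: real
  assumes c_pos: "0 < c" and c_le_1: "c \<le> 1"
    and expansion: "\<And>B. B \<subseteq> Y \<Longrightarrow> 2 * card B \<le> card Y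
      \<Longrightarrow> c * card B \<le> (\<Sum>x\<in>B. \<Sum>y\<in>Y-B. w x y)"
begin

text \<open>The layer-cake argument: peel off the lowest positive level of \<open>u\<close> and induct.\<close>

lemma coarea_le:
  fixes u :: "'a \<Rightarrow> real"
  assumes "\<And>x. x \<in> Y \<Longrightarrow> 0 \<le> u x" and "2 * card {x\<in>Y. 0 < u x} \<le> card Y"
  shows "c * (\<Sum>x\<in>Y. u x) \<le> (\<Sum>x\<in>Y. \<Sum>y\<in>Y. w x y * max (u x - u y) 0)"
  using assms
proof (induction "card {x\<in>Y. 0 < u x}" arbitrary: u rule: less_induct)
  case less
  define B where "B = {x\<in>Y. 0 < u x}"
  have B: "B \<subseteq> Y" "finite B" using finite_Y by (auto simp: B_def)
  show ?case
  proof (cases "B = {}")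
    case True
    then have "u x = 0" if "x \<in> Y" for x
      using less.prems(1)[OF that] that by (force simp: B_def)
    then show ?thesis by simp
  next
    case False
    define s where "s = Min (u ` B)"
    have s_le: "s \<le> u x" if "x \<in> B" for x using that B by (simp add: s_def)
    have "s \<in> u ` B" unfolding s_def using B False by (intro Min_in) auto
    then obtain z where z: "z \<in> B" "u z = s" by auto
    then have s_pos: "0 < s" by (auto simp: B_def)
    define v where "v = (\<lambda>x. if x \<in> B then u x - s else 0)"
    have v0: "0 \<le> v x" for x using s_le by (auto simp: v_def)
    have sub: "{x\<in>Y. 0 < v x} \<subset> B" using z by (auto simp: v_def B_def split: if_splits)
    then have lt: "card {x\<in>Y. 0 < v x} < card B" using B by (simp add: psubset_card_mono)
    then have IH: "c * (\<Sum>x\<in>Y. v x) \<le> (\<Sum>x\<in>Y. \<Sum>y\<in>Y. w x y * max (v x - v y) 0)"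
      using less.hyps[of v] v0 less.prems(2) by (simp add: B_def)
    have u_zero: "u x = 0" if "x \<in> Y" "x \<notin> B" for x
      using less.prems(1)[OF that(1)] that by (force simp: B_def)
    have u_eq: "u x = v x + s * of_bool (x \<in> B)" if "x \<in> Y" for x
      using u_zero that by (auto simp: v_def)
    \<comment> \<open>Lowering \<open>u\<close> by \<open>s\<close> on \<open>B\<close> alters the
      positive part of a difference only along pairs leaving \<open>B\<close>, and there by exactly
      \<open>s\<close>; so one layer contributes \<open>s\<close> times the cut weight of
      \<open>B\<close>.\<close>
    have max_eq: "max (u x - u y) 0 = max (v x - v y) 0 + s * of_bool (x \<in> B \<and> y \<notin> B)"
      if "x \<in> Y" "y \<in> Y" for x y
      using that s_le s_pos u_zero by (auto simp: v_def max_def dest: s_le)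
    have "c * (\<Sum>x\<in>Y. u x) = c * (\<Sum>x\<in>Y. v x) + s * (c * card B)"
    proof -
      have "(\<Sum>x\<in>Y. u x) = (\<Sum>x\<in>Y. v x) + s * (\<Sum>x\<in>Y. of_bool (x \<in> B))"
        by (simp add: u_eq sum.distrib sum_distrib_left del: sum_of_bool_eq)
      also have "(\<Sum>x\<in>Y. of_bool (x \<in> B) :: real) = card B"
        using B finite_Y by (simp add: Int_absorb1)
      finally show ?thesis by (simp add: algebra_simps)
    qed
    also have "\<dots> \<le> c * (\<Sum>x\<in>Y. v x) + s * (\<Sum>x\<in>B. \<Sum>y\<in>Y-B. w x y)"
      using expansion[OF B(1)] less.prems(2) s_pos by (simp add: B_def)
    also have "(\<Sum>x\<in>B. \<Sum>y\<in>Y-B. w x y) = (\<Sum>x\<in>Y. \<Sum>y\<in>Y. w x y * of_bool (x \<in> B \<and> y \<notin> B))"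
    proof -
      have "(\<Sum>y\<in>Y-B. w x y) = (\<Sum>y\<in>Y. w x y * of_bool (y \<notin> B))" for x
        using finite_Y by (intro sum.mono_neutral_cong_left) auto
      then have "(\<Sum>x\<in>B. \<Sum>y\<in>Y-B. w x y) = (\<Sum>x\<in>B. \<Sum>y\<in>Y. w x y * of_bool (y \<notin> B))"
        by simp
      also have "\<dots> = (\<Sum>x\<in>Y. \<Sum>y\<in>Y. w x y * of_bool (x \<in> B \<and> y \<notin> B))"
        using finite_Y B by (intro sum.mono_neutral_cong_left) auto
      finally show ?thesis .
    qed
    also have "c * (\<Sum>x\<in>Y. v x) + s * \<dots>
        \<le> (\<Sum>x\<in>Y. \<Sum>y\<in>Y. w x y * max (v x - v y) 0)
          + s * (\<Sum>x\<in>Y. \<Sum>y\<in>Y. w x y * of_bool (x \<in> B \<and> y \<notin> B))"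
      using IH by simp
    also have "\<dots> = (\<Sum>x\<in>Y. \<Sum>y\<in>Y. w x y * max (u x - u y) 0)"
      by (simp add: max_eq sum.distrib sum_distrib_left algebra_simps cong: sum.cong)
    finally show ?thesis .
  qed
qed

text \<open>The Cheeger bound for the sum over ordered pairs, which is twice the Dirichlet form. The
  value arises as \<open>c / 2\<close> times \<open>2 * t\<close> with the parameter
  \<open>t = c / (4 * K)\<close> of the next proof.\<close>

definition gap :: real where "gap = c\<^sup>2 / (4 * K)"

text \<open>The layer-cake bound is applied to the square of \<open>h\<close>. Factoring the
  difference of squares and splitting the product by a weighted AM-GM inequality leaves the
  Dirichlet sum and a multiple of the squared norm, which the degree bound controls and the left
  side absorbs.\<close>

lemma dirichlet_ge_of_small_support:
  fixes h :: "'a \<Rightarrow> real"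
  assumes h0: "\<And>x. x \<in> Y \<Longrightarrow> 0 \<le> h x" and supp: "2 * card {x\<in>Y. 0 < h x} \<le> card Y"
  shows "gap * (\<Sum>x\<in>Y. (h x)\<^sup>2) \<le> (\<Sum>x\<in>Y. \<Sum>y\<in>Y. w x y * (h x - h y)\<^sup>2)"
proof -
  define S where "S = (\<Sum>x\<in>Y. (h x)\<^sup>2)"
  define Q where "Q = (\<Sum>x\<in>Y. \<Sum>y\<in>Y. w x y * (h x - h y)\<^sup>2)"
  \<comment> \<open>Chosen so that the error term \<open>2 * K * t * S\<close> is exactly half of
    \<open>c * S\<close>.\<close>
  define t where "t = c / (4 * K)"
  have K: "0 < K" and t: "0 < t" using K_ge_1 c_pos by (auto simp: t_def)
  have "{x\<in>Y. 0 < (h x)\<^sup>2} = {x\<in>Y. 0 < h x}" using h0 by (auto simp: less_le)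
  then have "c * S \<le> (\<Sum>x\<in>Y. \<Sum>y\<in>Y. w x y * max ((h x)\<^sup>2 - (h y)\<^sup>2) 0)"
    unfolding S_def by (intro coarea_le) (use supp in auto)
  also have "\<dots> \<le> (\<Sum>x\<in>Y. \<Sum>y\<in>Y. w x y * ((h x - h y)\<^sup>2 / (2 * t) + t * (h x)\<^sup>2 + t * (h y)\<^sup>2))"
  proof (intro sum_mono mult_left_mono w_nonneg)
    fix x y assume "x \<in> Y" "y \<in> Y"
    define a b where "a = h x - h y" and "b = h x + h y"
    have am: "a * b \<le> a\<^sup>2 / (2 * t) + t / 2 * b\<^sup>2"
    proof -
      have "0 \<le> (a - t * b)\<^sup>2 / (2 * t)" using t by simp
      also have "\<dots> = a\<^sup>2 / (2 * t) + t / 2 * b\<^sup>2 - a * b"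
        using t by (simp add: field_simps power2_eq_square)
      finally show ?thesis by simp
    qed
    have "b\<^sup>2 \<le> 2 * (h x)\<^sup>2 + 2 * (h y)\<^sup>2"
      using zero_le_power2[of "h x - h y"] by (simp add: b_def power2_eq_square algebra_simps)
    then have b2: "t / 2 * b\<^sup>2 \<le> t * (h x)\<^sup>2 + t * (h y)\<^sup>2"
      using mult_left_mono[of "b\<^sup>2" "2 * (h x)\<^sup>2 + 2 * (h y)\<^sup>2" "t / 2"] t
      by (simp add: algebra_simps)
    have "(h x)\<^sup>2 - (h y)\<^sup>2 = a * b" by (simp add: a_def b_def power2_eq_square algebra_simps)
    then have "(h x)\<^sup>2 - (h y)\<^sup>2 \<le> a\<^sup>2 / (2 * t) + t * (h x)\<^sup>2 + t * (h y)\<^sup>2" using am b2 by linarith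
    then show "max ((h x)\<^sup>2 - (h y)\<^sup>2) 0 \<le> (h x - h y)\<^sup>2 / (2 * t) + t * (h x)\<^sup>2 + t * (h y)\<^sup>2"
      using t by (simp add: a_def)
  qed
  also have "\<dots> = Q / (2 * t) + (\<Sum>x\<in>Y. \<Sum>y\<in>Y. w x y * (t * (h x)\<^sup>2)) 
      + (\<Sum>x\<in>Y. \<Sum>y\<in>Y. w x y * (t * (h y)\<^sup>2))"
    by (simp add: Q_def sum.distrib sum_divide_distrib algebra_simps)
  also have "(\<Sum>x\<in>Y. \<Sum>y\<in>Y. w x y * (t * (h y)\<^sup>2)) = (\<Sum>x\<in>Y. \<Sum>y\<in>Y. w x y * (t * (h x)\<^sup>2))"
    by (rule sum_swap_sym)
  also have "(\<Sum>x\<in>Y. \<Sum>y\<in>Y. w x y * (t * (h x)\<^sup>2)) \<le> K * (t * S)"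
    using degree_sum_le[of "\<lambda>x. t * (h x)\<^sup>2"] t by (simp add: S_def sum_distrib_left)
  finally have "c * S \<le> Q / (2 * t) + 2 * K * t * S" by (simp add: algebra_simps)
  also have "2 * K * t * S = c / 2 * S" using K by (simp add: t_def)
  finally have "c / 2 * S \<le> Q / (2 * t)" by simp
  then have "c / 2 * S * (2 * t) \<le> Q" using t by (simp add: field_simps)
  also have "c / 2 * S * (2 * t) = gap * S" by (simp add: gap_def t_def power2_eq_square)
  finally show ?thesis by (simp add: Q_def S_def)
qed

end

text \<open>The smallest value with at most half of the points above it also has at most half below
  it: the next lower value \<open>m'\<close> has more than half above it, and the points above
  \<open>m'\<close> are exactly those not below \<open>m\<close>.\<close>

lemma median_exists:
  fixes f :: "'a \<Rightarrow> real"
  assumes "finite Y"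
  shows "\<exists>m. 2 * card {x\<in>Y. m < f x} \<le> card Y \<and> 2 * card {x\<in>Y. f x < m} \<le> card Y"
proof (cases "Y = {}")
  case False
  define V where "V = {v \<in> f ` Y. 2 * card {x\<in>Y. v < f x} \<le> card Y}"
  have fin: "finite V" using assms by (simp add: V_def)
  have "{x\<in>Y. Max (f ` Y) < f x} = {}" using assms by (auto simp: not_less)
  then have "2 * card {x\<in>Y. Max (f ` Y) < f x} \<le> card Y" by (simp only: card.empty)
  then have "Max (f ` Y) \<in> V" unfolding V_def using assms False by (simp del: Max_less_iff)
  then have ne: "V \<noteq> {}" by blast
  define m where "m = Min V"
  have m: "m \<in> V" unfolding m_def using fin ne by simp
  have "2 * card {x\<in>Y. f x < m} \<le> card Y"
  proof (cases "{x\<in>Y. f x < m} = {}")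
    case True
    then show ?thesis by (simp only: card.empty)
  next
    case ne': False
    define L where "L = f ` {x\<in>Y. f x < m}"
    have L: "finite L" "L \<noteq> {}" using ne' assms by (auto simp: L_def)
    define m' where "m' = Max L"
    have m': "m' \<in> L" unfolding m'_def using L by simp
    then have "m' < m" "m' \<in> f ` Y" by (auto simp: L_def)
    then have "m' \<notin> V" using Min_le[OF fin, of m'] by (auto simp: m_def)
    then have "card Y < 2 * card {x\<in>Y. m' < f x}" using \<open>m' \<in> f ` Y\<close> by (auto simp: V_def)
    moreover have "{x\<in>Y. m' < f x} = Y - {x\<in>Y. f x < m}"
    proof -
      have "f x \<le> m'" if "x \<in> Y" "f x < m" for x using that L by (auto simp: m'_def L_def)
      then show ?thesis using \<open>m' < m\<close> by force
    qed
    ultimately show ?thesis using assms by (simp add: card_Diff_subset)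
  qed
  then show ?thesis using m by (auto simp: V_def)
qed simp

context expander_graph
begin

text \<open>Cutting at a median rather than at the mean gives both parts of \<open>f - m\<close> a
  support of at most half the vertices. As \<open>f\<close> has mean zero, the shift by
  \<open>m\<close> can only enlarge the squared norm; and the two parts vary in opposite directions,
  so their Dirichlet sums together do not exceed that of \<open>f\<close>.\<close>

lemma poincare_real:
  fixes f :: "'a \<Rightarrow> real"
  assumes mean: "(\<Sum>x\<in>Y. f x) = 0"
  shows "gap * (\<Sum>x\<in>Y. (f x)\<^sup>2) \<le> (\<Sum>x\<in>Y. \<Sum>y\<in>Y. w x y * (f x - f y)\<^sup>2)"
proof -
  obtain m where m: "2 * card {x\<in>Y. m < f x} \<le> card Y" "2 * card {x\<in>Y. f x < m} \<le> card Y"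
    using median_exists[OF finite_Y, of f] by blast
  define p q where "p = (\<lambda>x. max (f x - m) 0)" and "q = (\<lambda>x. max (m - f x) 0)"
  have gap0: "0 \<le> gap" using K_ge_1 by (simp add: gap_def)
  have "{x\<in>Y. 0 < p x} = {x\<in>Y. m < f x}" "{x\<in>Y. 0 < q x} = {x\<in>Y. f x < m}"
    by (auto simp: p_def q_def)
  then have pq: "gap * (\<Sum>x\<in>Y. (p x)\<^sup>2) \<le> (\<Sum>x\<in>Y. \<Sum>y\<in>Y. w x y * (p x - p y)\<^sup>2)"
    "gap * (\<Sum>x\<in>Y. (q x)\<^sup>2) \<le> (\<Sum>x\<in>Y. \<Sum>y\<in>Y. w x y * (q x - q y)\<^sup>2)"
    using m by (auto intro!: dirichlet_ge_of_small_support simp: p_def q_def)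
  have "(\<Sum>x\<in>Y. (p x)\<^sup>2 + (q x)\<^sup>2) = (\<Sum>x\<in>Y. (f x)\<^sup>2 - 2 * m * f x + m\<^sup>2)"
    by (intro sum.cong refl) (auto simp: p_def q_def max_def power2_eq_square algebra_simps)
  also have "\<dots> = (\<Sum>x\<in>Y. (f x)\<^sup>2) + card Y * m\<^sup>2"
    using mean by (simp add: sum.distrib sum_subtractf flip: sum_distrib_left)
  finally have "(\<Sum>x\<in>Y. (f x)\<^sup>2) \<le> (\<Sum>x\<in>Y. (p x)\<^sup>2) + (\<Sum>x\<in>Y. (q x)\<^sup>2)"
    by (simp add: sum.distrib)
  then have "gap * (\<Sum>x\<in>Y. (f x)\<^sup>2) \<le> gap * ((\<Sum>x\<in>Y. (p x)\<^sup>2) + (\<Sum>x\<in>Y. (q x)\<^sup>2))"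
    using gap0 by (rule mult_left_mono)
  also have "\<dots> \<le> (\<Sum>x\<in>Y. \<Sum>y\<in>Y. w x y * ((p x - p y)\<^sup>2 + (q x - q y)\<^sup>2))"
    using pq by (simp add: sum.distrib algebra_simps)
  also have "\<dots> \<le> (\<Sum>x\<in>Y. \<Sum>y\<in>Y. w x y * (f x - f y)\<^sup>2)"
  proof (intro sum_mono mult_left_mono w_nonneg)
    fix x y
    have square: "a\<^sup>2 + b\<^sup>2 \<le> (a - b)\<^sup>2" if "a * b \<le> 0" for a b :: real
      using that by (simp add: power2_eq_square algebra_simps)
    have "f x - f y = (p x - p y) - (q x - q y)" by (auto simp: p_def q_def max_def)
    moreover have "(p x - p y) * (q x - q y) \<le> 0"
      by (auto simp: p_def q_def max_def mult_le_0_iff)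
    ultimately show "(p x - p y)\<^sup>2 + (q x - q y)\<^sup>2 \<le> (f x - f y)\<^sup>2"
      using square by metis
  qed
  finally show ?thesis .
qed

lemma poincare:
  fixes f :: "'a \<Rightarrow> complex"
  assumes mean: "(\<Sum>x\<in>Y. f x) = 0"
  shows "gap * (\<Sum>x\<in>Y. (cmod (f x))\<^sup>2) \<le> (\<Sum>x\<in>Y. \<Sum>y\<in>Y. w x y * (cmod (f x - f y))\<^sup>2)"
proof -
  have "(\<Sum>x\<in>Y. Re (f x)) = 0" "(\<Sum>x\<in>Y. Im (f x)) = 0"
    using mean by (metis Re_sum zero_complex.simps(1), metis Im_sum zero_complex.simps(2))
  then show ?thesis
    using poincare_real[of "\<lambda>x. Re (f x)"] poincare_real[of "\<lambda>x. Im (f x)"]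
    by (simp add: cmod_power2 sum.distrib algebra_simps)
qed

end

section \<open>The lazy random walk and its rate of convergence\<close>

definition laplacian :: "'a set \<Rightarrow> ('a \<Rightarrow> 'a \<Rightarrow> real) \<Rightarrow> ('a \<Rightarrow> complex) \<Rightarrow> 'a \<Rightarrow> complex" where
  "laplacian Y w f x = (\<Sum>y\<in>Y. w x y *\<^sub>R (f x - f y))"

text \<open>The operator I - L/(2K) with L the Laplacian. For symmetric weights with degrees at most
  \<open>K\<close>, L lies between 0 and 2K as a quadratic form, so this walk has no negative
  eigenvalues.\<close>

definition diffusion ::
  "'a set \<Rightarrow> ('a \<Rightarrow> 'a \<Rightarrow> real) \<Rightarrow> real \<Rightarrow> ('a \<Rightarrow> complex) \<Rightarrow> 'a \<Rightarrow> complex" where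
  "diffusion Y w K f x = (if x \<in> Y then f x - (1 / (2 * K)) *\<^sub>R laplacian Y w f x else 0)"

lemma diffusion_add: "diffusion Y w K (\<lambda>x. f x + g x) = (\<lambda>x. diffusion Y w K f x + diffusion Y w K g x)"
  by (auto simp: diffusion_def laplacian_def fun_eq_iff sum.distrib sum_subtractf algebra_simps)

lemma diffusion_scale: "diffusion Y w K (\<lambda>x. a * f x) = (\<lambda>x. a * diffusion Y w K f x)"
  by (auto simp: diffusion_def laplacian_def fun_eq_iff sum_distrib_left algebra_simps)

lemma diffusion_pow_add:
  "(diffusion Y w K ^^ k) (\<lambda>x. f x + g x) = (\<lambda>x. (diffusion Y w K ^^ k) f x + (diffusion Y w K ^^ k) g x)"
  by (induction k) (simp_all add: diffusion_add)

lemma diffusion_pow_scale: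
  "(diffusion Y w K ^^ k) (\<lambda>x. a * f x) = (\<lambda>x. a * (diffusion Y w K ^^ k) f x)"
  by (induction k) (simp_all add: diffusion_scale)

lemma diffusion_pow_const:
  "(diffusion Y w K ^^ k) (chi Y (\<lambda>_. a)) = chi Y (\<lambda>_. a)"
proof (induction k)
  case (Suc k)
  have "diffusion Y w K (chi Y (\<lambda>_. a)) = chi Y (\<lambda>_. a)"
    by (auto simp: diffusion_def laplacian_def chi_def fun_eq_iff intro!: sum.neutral)
  then show ?case using Suc by simp
qed simp

lemma diffusion_pow_outside:
  assumes "\<And>x. x \<notin> Y \<Longrightarrow> f x = 0" "x \<notin> Y" shows "(diffusion Y w K ^^ k) f x = 0"
  using assms by (cases k) (auto simp: diffusion_def)

context weighted_graph
begin

lemma sum_diffusion: "(\<Sum>x\<in>Y. diffusion Y w K f x) = (\<Sum>x\<in>Y. f x)"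
proof -
  have "(\<Sum>x\<in>Y. laplacian Y w f x) = (\<Sum>x\<in>Y. \<Sum>y\<in>Y. w x y *\<^sub>R f x) - (\<Sum>x\<in>Y. \<Sum>y\<in>Y. w x y *\<^sub>R f y)"
    by (simp add: laplacian_def scaleR_diff_right sum_subtractf)
  also have "(\<Sum>x\<in>Y. \<Sum>y\<in>Y. w x y *\<^sub>R f y) = (\<Sum>x\<in>Y. \<Sum>y\<in>Y. w x y *\<^sub>R f x)"
    by (subst sum.swap) (simp add: w_sym)
  finally show ?thesis
    by (simp add: diffusion_def sum_subtractf flip: scaleR_right.sum)
qed

lemma inner_laplacian:
  "2 * (\<Sum>x\<in>Y. inner (f x) (laplacian Y w f x)) = (\<Sum>x\<in>Y. \<Sum>y\<in>Y. w x y * (cmod (f x - f y))\<^sup>2)"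
proof -
  have "(\<Sum>x\<in>Y. \<Sum>y\<in>Y. w x y * (cmod (f x - f y))\<^sup>2)
      = (\<Sum>x\<in>Y. \<Sum>y\<in>Y. w x y * inner (f x) (f x - f y)) + (\<Sum>x\<in>Y. \<Sum>y\<in>Y. w x y * inner (f y) (f y - f x))"
    by (simp add: power2_norm_eq_inner inner_diff inner_commute algebra_simps flip: sum.distrib)
  also have "(\<Sum>x\<in>Y. \<Sum>y\<in>Y. w x y * inner (f y) (f y - f x)) = (\<Sum>x\<in>Y. \<Sum>y\<in>Y. w x y * inner (f x) (f x - f y))"
    by (rule sum_swap_sym)
  finally show ?thesis by (simp add: laplacian_def inner_sum_right)
qed

text \<open>Cauchy-Schwarz at each vertex, with the weight split into two square roots. Combined
  with the preceding identity it says that L^2 is at most 2K L, which takes the place of a spectral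
  argument.\<close>

lemma norm_laplacian_le:
  "(\<Sum>x\<in>Y. (cmod (laplacian Y w f x))\<^sup>2) \<le> K * (\<Sum>x\<in>Y. \<Sum>y\<in>Y. w x y * (cmod (f x - f y))\<^sup>2)"
proof -
  have "(cmod (laplacian Y w f x))\<^sup>2 \<le> K * (\<Sum>y\<in>Y. w x y * (cmod (f x - f y))\<^sup>2)" if x: "x \<in> Y" for x
  proof -
    have "cmod (laplacian Y w f x) \<le> (\<Sum>y\<in>Y. w x y * cmod (f x - f y))"
      unfolding laplacian_def by (rule order_trans[OF norm_sum]) (simp add: w_nonneg)
    also have "\<dots> = (\<Sum>y\<in>Y. sqrt (w x y) * (sqrt (w x y) * cmod (f x - f y)))"
      by (simp add: w_nonneg flip: mult.assoc)
    finally have "(cmod (laplacian Y w f x))\<^sup>2 \<le> (\<Sum>y\<in>Y. sqrt (w x y) * (sqrt (w x y) * cmod (f x - f y)))\<^sup>2"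
      by (intro power_mono) auto
    also have "\<dots> \<le> (\<Sum>y\<in>Y. w x y) * (\<Sum>y\<in>Y. w x y * (cmod (f x - f y))\<^sup>2)"
      by (rule order_trans[OF Cauchy_Schwarz_ineq_sum]) (simp add: w_nonneg power_mult_distrib)
    also have "\<dots> \<le> K * (\<Sum>y\<in>Y. w x y * (cmod (f x - f y))\<^sup>2)"
      using degree_le[OF x] by (intro mult_right_mono sum_nonneg) (auto simp: w_nonneg)
    finally show ?thesis .
  qed
  then show ?thesis by (simp add: sum_distrib_left[of K] sum_mono)
qed

text \<open>Expanding the square, the cross term gains Q/(2K) and the quadratic term costs at most
  Q/(4K), so half of the gain survives.\<close>

lemma norm_diffusion_le:
  "(\<Sum>x\<in>Y. (cmod (diffusion Y w K f x))\<^sup>2)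
     \<le> (\<Sum>x\<in>Y. (cmod (f x))\<^sup>2) - (\<Sum>x\<in>Y. \<Sum>y\<in>Y. w x y * (cmod (f x - f y))\<^sup>2) / (4 * K)"
proof -
  define Q where "Q = (\<Sum>x\<in>Y. \<Sum>y\<in>Y. w x y * (cmod (f x - f y))\<^sup>2)"
  let ?L = "laplacian Y w f"
  have K: "0 < K" using K_ge_1 by simp
  have "(cmod (diffusion Y w K f x))\<^sup>2
      = (cmod (f x))\<^sup>2 - inner (f x) (?L x) / K + (cmod (?L x))\<^sup>2 / (4 * K\<^sup>2)" if "x \<in> Y" for x
    using that K unfolding diffusion_def if_P[OF that] power2_norm_eq_inner
    by (simp add: inner_diff inner_commute field_simps power2_eq_square)
  then have "(\<Sum>x\<in>Y. (cmod (diffusion Y w K f x))\<^sup>2)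
      = (\<Sum>x\<in>Y. (cmod (f x))\<^sup>2) - (\<Sum>x\<in>Y. inner (f x) (?L x)) / K + (\<Sum>x\<in>Y. (cmod (?L x))\<^sup>2) / (4 * K\<^sup>2)"
    by (simp add: sum.distrib sum_subtractf sum_divide_distrib)
  also have "(\<Sum>x\<in>Y. inner (f x) (?L x)) = Q / 2"
    using inner_laplacian[of f] by (simp add: Q_def)
  also have "(\<Sum>x\<in>Y. (cmod (?L x))\<^sup>2) / (4 * K\<^sup>2) \<le> K * Q / (4 * K\<^sup>2)"
    unfolding Q_def by (intro divide_right_mono norm_laplacian_le) simp
  also have "K * Q / (4 * K\<^sup>2) = Q / (4 * K)" using K by (simp add: power2_eq_square)
  finally show ?thesis using K by (simp add: Q_def)
qed

end

context expander_graph
begin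

text \<open>Contraction factor per step of the squared norm. It involves only \<open>K\<close> and
  \<open>c\<close>, so all graphs with the same two constants share it.\<close>

definition rate :: real where "rate = 1 - gap / (4 * K)"

lemma rate_nonneg: "0 \<le> rate" and rate_less_1: "rate < 1"
proof -
  have "c\<^sup>2 \<le> 1" using c_pos c_le_1 by (simp add: power_le_one)
  moreover have "1 \<le> K * K" using K_ge_1 mult_mono[of 1 K 1 K] by simp
  ultimately show "0 \<le> rate" using K_ge_1 by (simp add: rate_def gap_def field_simps)
  show "rate < 1" using K_ge_1 c_pos by (simp add: rate_def gap_def)
qed

lemma norm_diffusion_pow_le:
  assumes "(\<Sum>x\<in>Y. f x) = 0"
  shows "(\<Sum>x\<in>Y. (cmod ((diffusion Y w K ^^ k) f x))\<^sup>2) \<le> rate ^ k * (\<Sum>x\<in>Y. (cmod (f x))\<^sup>2)"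
proof (induction k)
  case (Suc k)
  let ?g = "(diffusion Y w K ^^ k) f"
  \<comment> \<open>The walk preserves the total sum, so the Poincare inequality applies again at
    every step.\<close>
  have "(\<Sum>x\<in>Y. ?g x) = 0" using assms by (induction k) (simp_all add: sum_diffusion)
  then have "(\<Sum>x\<in>Y. (cmod (diffusion Y w K ?g x))\<^sup>2)
      \<le> (\<Sum>x\<in>Y. (cmod (?g x))\<^sup>2) - gap * (\<Sum>x\<in>Y. (cmod (?g x))\<^sup>2) / (4 * K)"
    using norm_diffusion_le[of ?g] poincare[of ?g] K_ge_1
    by (smt (verit) divide_right_mono)
  also have "\<dots> = rate * (\<Sum>x\<in>Y. (cmod (?g x))\<^sup>2)" by (simp add: rate_def algebra_simps)
  also have "\<dots> \<le> rate * (rate ^ k * (\<Sum>x\<in>Y. (cmod (f x))\<^sup>2))"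
    using Suc rate_nonneg by (rule mult_left_mono)
  finally show ?case by (simp add: mult.assoc)
qed simp

end

section \<open>Averages over a set, over a large subset, and the walk\<close>

lemma norm_sum_square_le: "(cmod (\<Sum>x\<in>A. f x))\<^sup>2 \<le> card A * (\<Sum>x\<in>A. (cmod (f x))\<^sup>2)"
proof -
  have "(cmod (\<Sum>x\<in>A. f x))\<^sup>2 \<le> (\<Sum>x\<in>A. 1 * cmod (f x))\<^sup>2"
    by (intro power_mono) (auto intro: norm_sum)
  also have "\<dots> \<le> (\<Sum>x\<in>A. 1\<^sup>2) * (\<Sum>x\<in>A. (cmod (f x))\<^sup>2)" by (rule Cauchy_Schwarz_ineq_sum)
  finally show ?thesis by simp
qed

lemma norm_add_square_le: "(norm (a + b :: 'b::real_inner))\<^sup>2 \<le> 2 * (norm a)\<^sup>2 + 2 * (norm b)\<^sup>2"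
  using zero_le_power2[of "norm (a - b)"] 
  by (simp add: power2_norm_eq_inner inner_add inner_diff inner_commute del: zero_le_power2)

definition mean :: "'a set \<Rightarrow> ('a \<Rightarrow> complex) \<Rightarrow> complex" where
  "mean Y f = (\<Sum>y\<in>Y. f y) / of_nat (card Y)"

lemma norm_mean_square_le:
  assumes "finite Y"
  shows "card Y * (cmod (mean Y f))\<^sup>2 \<le> (\<Sum>x\<in>Y. (cmod (f x))\<^sup>2)"
proof (cases "card Y = 0")
  case False
  then show ?thesis using norm_sum_square_le[of f Y]
    by (simp add: mean_def norm_divide field_simps power2_eq_square)
qed (use assms in simp)

context expander_graph
begin

text \<open>The walk fixes constants on \<open>Y\<close>, so subtracting the mean commutes with
  iteration and reduces to functions of sum zero; the subtraction is an orthogonal projection and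
  does not increase the norm.\<close>

lemma norm_diffusion_pow_minus_mean_le:
  "(\<Sum>x\<in>Y. (cmod ((diffusion Y w K ^^ k) (chi Y f) x - mean Y f))\<^sup>2) \<le> rate ^ k * (\<Sum>x\<in>Y. (cmod (f x))\<^sup>2)"
proof -
  define g where "g = (\<lambda>x. chi Y f x + (-1) * chi Y (\<lambda>_. mean Y f) x)"
  have *: "(diffusion Y w K ^^ k) g x = (diffusion Y w K ^^ k) (chi Y f) x - mean Y f" if "x \<in> Y" for x
    unfolding g_def diffusion_pow_add diffusion_pow_scale diffusion_pow_const
    using that by (simp add: chi_def)
  have g: "g x = f x - mean Y f" if "x \<in> Y" for x using that by (simp add: g_def chi_def)
  have m: "of_nat (card Y) * mean Y f = (\<Sum>x\<in>Y. f x)"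
    using finite_Y by (cases "Y = {}") (simp_all add: mean_def)
  have sg: "(\<Sum>x\<in>Y. g x) = 0" using m by (simp add: g sum_subtractf)
  have "(\<Sum>x\<in>Y. (cmod (g x))\<^sup>2) \<le> (\<Sum>x\<in>Y. (cmod (f x))\<^sup>2)"
  proof -
    have "(\<Sum>x\<in>Y. (cmod (f x))\<^sup>2) = (\<Sum>x\<in>Y. (cmod (g x))\<^sup>2 + 2 * inner (g x) (mean Y f) + (cmod (mean Y f))\<^sup>2)"
      by (intro sum.cong refl) (simp add: g power2_norm_eq_inner inner_diff inner_commute)
    also have "\<dots> = (\<Sum>x\<in>Y. (cmod (g x))\<^sup>2) + 2 * inner (\<Sum>x\<in>Y. g x) (mean Y f) + card Y * (cmod (mean Y f))\<^sup>2"
      by (simp add: sum.distrib inner_sum_left sum_distrib_left)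
    finally show ?thesis by (simp add: sg)
  qed
  then show ?thesis
    using norm_diffusion_pow_le[OF sg, of k] rate_nonneg
    by (simp add: * cong: sum.cong) (meson mult_left_mono order_trans zero_le_power)
qed

end

text \<open>The mean over \<open>X\<close> is split into the contributions of \<open>X - Y\<close>
  and of \<open>Y\<close>. The first is small because few points contribute; the second differs
  little from the mean over \<open>Y\<close> extended by zero. Each squared error is at most
  \<alpha> times the squared norm, and the square of a sum costs a factor 2 on both.\<close>

lemma norm_mean_minus_mean_subset_le:
  assumes "finite X" "Y \<subseteq> X" "Y \<noteq> {}" and small: "real (card (X - Y)) \<le> \<alpha> * real (card X)"
  shows "(\<Sum>x\<in>X. (cmod (mean X f - chi Y (\<lambda>_. mean Y f) x))\<^sup>2) \<le> 4 * \<alpha> * (\<Sum>x\<in>X. (cmod (f x))\<^sup>2)"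
proof -
  have finY: "finite Y" and X: "X \<noteq> {}" using assms finite_subset by auto
  define A p q where "A = X - Y" and "p = (\<Sum>x\<in>X-Y. f x) / of_nat (card X)" 
    and "q = (\<Sum>x\<in>Y. f x)"
  define a y n where "a = real (card A)" and "y = real (card Y)" and "n = real (card X)"
  have n: "n = a + y" using assms finY by (simp add: n_def a_def y_def A_def card_Diff_subset card_mono)
  have pos: "0 < y" "0 < n" "0 \<le> a" using assms finY X by (auto simp: y_def n_def a_def card_gt_0_iff)
  have al: "a / n \<le> \<alpha>" using small pos by (simp add: a_def n_def A_def field_simps)
  let ?N = "\<Sum>x\<in>X. (cmod (f x))\<^sup>2"
  have split: "(\<Sum>x\<in>X. F x) = (\<Sum>x\<in>A. F x) + (\<Sum>x\<in>Y. F x)" for F :: "'a \<Rightarrow> 'b::comm_monoid_add"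
    unfolding A_def using assms by (simp add: sum.subset_diff)
  have mX: "mean X f = p + q / of_nat (card X)"
    by (simp add: mean_def p_def q_def split A_def add_divide_distrib)
  have N0: "0 \<le> ?N" by (simp add: sum_nonneg)
  have NA: "(\<Sum>x\<in>A. (cmod (f x))\<^sup>2) \<le> ?N" and NY: "(\<Sum>x\<in>Y. (cmod (f x))\<^sup>2) \<le> ?N"
    using assms by (auto intro!: sum_mono2 simp: A_def)
  have "n * (cmod p)\<^sup>2 = (cmod (\<Sum>x\<in>A. f x))\<^sup>2 / n"
    using pos by (simp add: p_def A_def norm_divide n_def power2_eq_square)
  also have "\<dots> \<le> a * ?N / n"
    using norm_sum_square_le[of f A] mult_left_mono[OF NA pos(3)] pos
    by (intro divide_right_mono) (auto simp: a_def)
  finally have p: "n * (cmod p)\<^sup>2 \<le> a / n * ?N" by simp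
  have q2: "(cmod q)\<^sup>2 \<le> y * ?N"
    using norm_sum_square_le[of f Y] mult_left_mono[OF NY less_imp_le[OF pos(1)]]
    unfolding q_def y_def by linarith
  have cx: "cmod (q / of_nat (card X) - chi Y (\<lambda>_. mean Y f) x) = cmod q * (if x \<in> Y then a / (n * y) else 1 / n)" for x
  proof (cases "x \<in> Y")
    case True
    have "q / of_nat (card X) - mean Y f = q * of_real (1 / n - 1 / y)"
      by (simp add: mean_def q_def n_def y_def algebra_simps)
    also have "1 / n - 1 / y = - (a / (n * y))" using pos n by (simp add: field_simps)
    finally show ?thesis using True pos by (simp add: chi_def norm_mult norm_divide)
  qed (use pos in \<open>simp add: chi_def norm_divide n_def\<close>)
  have "(\<Sum>x\<in>X. (cmod (q / of_nat (card X) - chi Y (\<lambda>_. mean Y f) x))\<^sup>2)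
      = a * (cmod q * (1 / n))\<^sup>2 + y * (cmod q * (a / (n * y)))\<^sup>2"
    unfolding split cx by (simp add: A_def a_def y_def)
  also have "\<dots> = (cmod q)\<^sup>2 * (a / n / n + a * a / (n * n) / y)"
    using pos by (simp add: field_simps power2_eq_square)
  \<comment> \<open>The errors off \<open>Y\<close> and on \<open>Y\<close> combine through
    \<open>n = a + y\<close> into one fraction, whose \<open>y\<close> cancels against the
    Cauchy-Schwarz bound for \<open>q\<close>.\<close>
  also have "a / n / n + a * a / (n * n) / y = a / (n * y)"
    using pos unfolding n by (simp add: divide_simps) (simp add: algebra_simps)
  also have "(cmod q)\<^sup>2 * (a / (n * y)) \<le> (y * ?N) * (a / (n * y))"
    using q2 pos by (intro mult_right_mono) auto
  also have "\<dots> = a / n * ?N" using pos by simp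
  finally have r: "(\<Sum>x\<in>X. (cmod (q / of_nat (card X) - chi Y (\<lambda>_. mean Y f) x))\<^sup>2) \<le> a / n * ?N" .
  have "(\<Sum>x\<in>X. (cmod (mean X f - chi Y (\<lambda>_. mean Y f) x))\<^sup>2)
      \<le> (\<Sum>x\<in>X. 2 * (cmod p)\<^sup>2 + 2 * (cmod (q / of_nat (card X) - chi Y (\<lambda>_. mean Y f) x))\<^sup>2)"
    unfolding mX add_diff_eq[symmetric] by (intro sum_mono norm_add_square_le)
  also have "\<dots> = 2 * (n * (cmod p)\<^sup>2) + 2 * (\<Sum>x\<in>X. (cmod (q / of_nat (card X) - chi Y (\<lambda>_. mean Y f) x))\<^sup>2)"
    by (simp add: sum.distrib n_def flip: sum_distrib_left)
  also have "\<dots> \<le> 4 * (a / n * ?N)" using p r by linarith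
  also have "\<dots> \<le> 4 * (\<alpha> * ?N)" using al N0 by (intro mult_left_mono mult_right_mono) auto
  finally show ?thesis by (simp add: mult.assoc)
qed

text \<open>One step at \<open>x\<close> reads only \<open>x\<close> itself and points within
  \<open>R\<close>, so influence travels at most \<open>R\<close> per step; this becomes the
  propagation bound.\<close>

lemma diffusion_pow_support:
  assumes "(diffusion Y w K ^^ k) f x \<noteq> 0"
    and "Metric_space X d" "Y \<subseteq> X" "\<And>x. x \<notin> Y \<Longrightarrow> f x = 0" "\<And>x y. d x y > R \<Longrightarrow> w x y = 0" 
    and "0 \<le> R"
  shows "\<exists>y\<in>Y. f y \<noteq> 0 \<and> d x y \<le> real k * R"
  using assms(1)
proof (induction k arbitrary: x)
  case 0
  then have "x \<in> Y" using assms(4) by fastforce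
  then show ?case using 0 assms(3) Metric_space.mdist_zero[OF assms(2), of x] by force
next
  case (Suc k)
  let ?g = "(diffusion Y w K ^^ k) f"
  have x: "x \<in> Y" and ne: "?g x - (1 / (2 * K)) *\<^sub>R laplacian Y w ?g x \<noteq> 0"
    using Suc.prems by (auto simp: diffusion_def[of _ _ _ ?g] split: if_splits)
  have "\<exists>y\<in>Y. ?g y \<noteq> 0 \<and> d x y \<le> R"
  proof (rule ccontr)
    assume *: "\<not> ?thesis"
    then have gx: "?g x = 0" using x assms(3,6) Metric_space.mdist_zero[OF assms(2), of x] by force
    have "w x y *\<^sub>R ?g y = 0" if "y \<in> Y" for y using * that assms(5)[of x y] by force
    then have "laplacian Y w ?g x = 0"
      unfolding laplacian_def using gx by (intro sum.neutral) (simp add: scaleR_diff_right)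
    then show False using ne gx by simp
  qed
  then obtain y where y: "y \<in> Y" "?g y \<noteq> 0" "d x y \<le> R" by blast
  then obtain z where z: "z \<in> Y" "f z \<noteq> 0" "d y z \<le> real k * R"
    using Suc.IH[of y] by blast
  have "d x z \<le> d x y + d y z"
    using Metric_space.triangle[OF assms(2)] x y z assms(3) by blast
  also have "\<dots> \<le> real (Suc k) * R" using y z by (simp add: algebra_simps)
  finally show ?case using z by blast
qed

section \<open>Operators on square-summable functions\<close>

lemma ell2_norm_square: "(ell2_norm X f)\<^sup>2 = (\<Sum>\<^sub>\<infinity>x\<in>X. (cmod (f x))\<^sup>2)"
  by (simp add: ell2_norm_def infsum_nonneg)

lemma ell2_norm_nonneg [simp]: "0 \<le> ell2_norm X f"
  by (simp add: ell2_norm_def infsum_nonneg)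

lemma ell2_summable: "f \<in> ell2 X \<Longrightarrow> (\<lambda>x. (cmod (f x))\<^sup>2) summable_on X"
  by (simp add: ell2_def)

lemma sum_le_ell2_norm_square:
  assumes "f \<in> ell2 X" "finite F" "F \<subseteq> X"
  shows "(\<Sum>x\<in>F. (cmod (f x))\<^sup>2) \<le> (ell2_norm X f)\<^sup>2"
  unfolding ell2_norm_square using assms by (intro finite_sum_le_infsum ell2_summable) auto

lemma norm_le_ell2_norm:
  assumes "f \<in> ell2 X" "x \<in> X" shows "cmod (f x) \<le> ell2_norm X f"
  using sum_le_ell2_norm_square[OF assms(1), of "{x}"] assms(2) by (auto intro: power2_le_imp_le)

text \<open>Reduces membership and the norm bound to estimates on finite sets, the form in which
  blockwise inequalities are available.\<close>

lemma ell2I_finite_sums: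
  assumes "\<And>x. x \<notin> X \<Longrightarrow> f x = 0"
    and "\<And>F. finite F \<Longrightarrow> F \<subseteq> X \<Longrightarrow> (\<Sum>x\<in>F. (cmod (f x))\<^sup>2) \<le> B\<^sup>2" and "0 \<le> B"
  shows "f \<in> ell2 X" and "ell2_norm X f \<le> B"
proof -
  have s: "(\<lambda>x. (cmod (f x))\<^sup>2) summable_on X"
    using assms(2) by (intro nonneg_bdd_above_summable_on bdd_aboveI[of _ "B\<^sup>2"]) auto
  then show "f \<in> ell2 X" using assms(1) by (simp add: ell2_def)
  have "(ell2_norm X f)\<^sup>2 \<le> B\<^sup>2"
    unfolding ell2_norm_square using s assms(2) by (intro infsum_le_finite_sums) auto
  then show "ell2_norm X f \<le> B" using assms(3) by (rule power2_le_imp_le)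
qed

lemma ell2_dominated:
  assumes "f \<in> ell2 X" "\<And>x. cmod (g x) \<le> cmod (f x)"
  shows "g \<in> ell2 X" and "ell2_norm X g \<le> ell2_norm X f"
proof -
  have "(\<Sum>x\<in>F. (cmod (g x))\<^sup>2) \<le> (ell2_norm X f)\<^sup>2" if "finite F" "F \<subseteq> X" for F
    using sum_mono[of F "\<lambda>x. (cmod (g x))\<^sup>2" "\<lambda>x. (cmod (f x))\<^sup>2"] assms(2)
      sum_le_ell2_norm_square[OF assms(1) that] by (force intro: power_mono)
  moreover have "g x = 0" if "x \<notin> X" for x using assms(1) assms(2)[of x] that by (simp add: ell2_def)
  ultimately show "g \<in> ell2 X" and "ell2_norm X g \<le> ell2_norm X f"
    using ell2I_finite_sums[of X g "ell2_norm X f"] by simp_all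
qed

lemma chi_in_ell2: "f \<in> ell2 X \<Longrightarrow> chi A f \<in> ell2 X"
  and ell2_norm_chi_le: "f \<in> ell2 X \<Longrightarrow> ell2_norm X (chi A f) \<le> ell2_norm X f"
  using ell2_dominated[of f X "chi A f"] by (simp_all add: chi_def)

text \<open>The factor 2 comes from bounding the square of a sum in place of the triangle
  inequality; the norm estimate serves to make operator norms of differences finite.\<close>

lemma ell2_diff:
  assumes "f \<in> ell2 X" "g \<in> ell2 X"
  shows "(\<lambda>x. f x - g x) \<in> ell2 X"
    and "ell2_norm X (\<lambda>x. f x - g x) \<le> 2 * (ell2_norm X f + ell2_norm X g)"
proof -
  let ?B = "2 * (ell2_norm X f + ell2_norm X g)"
  have "(\<Sum>x\<in>F. (cmod (f x - g x))\<^sup>2) \<le> ?B\<^sup>2" if F: "finite F" "F \<subseteq> X" for F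
  proof -
    have "(\<Sum>x\<in>F. (cmod (f x - g x))\<^sup>2) \<le> (\<Sum>x\<in>F. 2 * (cmod (f x))\<^sup>2 + 2 * (cmod (g x))\<^sup>2)"
      using norm_add_square_le[of "f x" "- g x" for x] by (intro sum_mono) simp
    also have "\<dots> \<le> 2 * (ell2_norm X f)\<^sup>2 + 2 * (ell2_norm X g)\<^sup>2"
      using sum_le_ell2_norm_square[OF assms(1) F] sum_le_ell2_norm_square[OF assms(2) F]
      by (simp add: sum.distrib flip: sum_distrib_left)
    also have "\<dots> \<le> ?B\<^sup>2"
      using mult_nonneg_nonneg[OF ell2_norm_nonneg[of X f] ell2_norm_nonneg[of X g]]
      by (simp add: power2_eq_square algebra_simps)
    finally show ?thesis .
  qed
  then show "(\<lambda>x. f x - g x) \<in> ell2 X" "ell2_norm X (\<lambda>x. f x - g x) \<le> ?B"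
    by (rule ell2I_finite_sums[rotated]; use assms in \<open>simp add: ell2_def\<close>)+
qed

lemma zero_in_ell2 [simp]: "(\<lambda>_. 0) \<in> ell2 X" and ell2_norm_zero [simp]: "ell2_norm X (\<lambda>_. 0) = 0"
  by (auto simp: ell2_def ell2_norm_def)

lemma bounded_opsE:
  assumes "T \<in> bounded_ops X"
  obtains C where "0 \<le> C" "\<And>f. f \<in> ell2 X \<Longrightarrow> ell2_norm X (T f) \<le> C * ell2_norm X f"
proof -
  obtain C where C: "\<forall>f\<in>ell2 X. ell2_norm X (T f) \<le> C * ell2_norm X f"
    using assms by (auto simp: bounded_ops_def)
  have "ell2_norm X (T f) \<le> max C 0 * ell2_norm X f" if "f \<in> ell2 X" for f
    by (rule order_trans[OF bspec[OF C that]]) (simp add: mult_right_mono)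
  then show ?thesis using that[of "max C 0"] by simp
qed

lemma bounded_ops_closed: "T \<in> bounded_ops X \<Longrightarrow> f \<in> ell2 X \<Longrightarrow> T f \<in> ell2 X"
  by (auto simp: bounded_ops_def)

lemma bounded_ops_add:
  "T \<in> bounded_ops X \<Longrightarrow> f \<in> ell2 X \<Longrightarrow> g \<in> ell2 X \<Longrightarrow> T (\<lambda>x. f x + g x) = (\<lambda>x. T f x + T g x)"
  and bounded_ops_scale:
  "T \<in> bounded_ops X \<Longrightarrow> f \<in> ell2 X \<Longrightarrow> T (\<lambda>x. c * f x) = (\<lambda>x. c * T f x)"
  by (simp_all add: bounded_ops_def)

lemma bounded_ops_zero: "T \<in> bounded_ops X \<Longrightarrow> T (\<lambda>_. 0) = (\<lambda>_. 0)"
  using bounded_ops_scale[of T X "\<lambda>_. 0" 0] by simp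

lemma op_norm_le:
  assumes "\<And>f. f \<in> ell2 X \<Longrightarrow> ell2_norm X f \<le> 1 \<Longrightarrow> ell2_norm X (T f) \<le> B"
  shows "op_norm X T \<le> B"
  unfolding op_norm_def by (rule cSUP_least) (use assms in \<open>auto intro!: exI[of _ "\<lambda>_. 0"]\<close>)

text \<open>The bound \<open>B\<close> makes the set of values bounded above; otherwise a supremum
  of reals says nothing about its members.\<close>

lemma ell2_norm_le_op_norm:
  assumes "\<And>f. f \<in> ell2 X \<Longrightarrow> ell2_norm X f \<le> 1 \<Longrightarrow> ell2_norm X (T f) \<le> B"
    and "f \<in> ell2 X" "ell2_norm X f \<le> 1"
  shows "ell2_norm X (T f) \<le> op_norm X T"
  unfolding op_norm_def by (rule cSUP_upper) (use assms in \<open>auto intro!: bdd_aboveI[of _ B]\<close>)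

text \<open>Finitely supported vectors are dense, and on those the claim is linear algebra.\<close>

lemma bounded_op_eq_0_of_entries:
  assumes T: "T \<in> bounded_ops X" and g: "g \<in> ell2 X" and x: "x \<in> X"
    and 0: "\<And>y. y \<in> X \<Longrightarrow> g y \<noteq> 0 \<Longrightarrow> matrix_entry T x y = 0"
  shows "T g x = 0"
proof -
  have fin: "T (chi F g) x = 0" if "finite F" "F \<subseteq> X" for F
    using that
  proof (induction F)
    case empty
    then show ?case using bounded_ops_zero[OF T] by (simp add: chi_def)
  next
    case (insert y F)
    have "chi (insert y F) g = (\<lambda>x. chi F g x + g y * delta y x)"
      using insert by (auto simp: chi_def delta_def)
    moreover have dl: "delta y \<in> ell2 X" using insert by (intro delta_in_ell2) auto
    then have "(\<lambda>x. g y * delta y x) \<in> ell2 X"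
      using ell2_dominated(1)[OF chi_in_ell2[OF g, of "{y}"], of "\<lambda>x. g y * delta y x"]
      by (simp add: chi_def delta_def)
    ultimately have "T (chi (insert y F) g) x = T (chi F g) x + g y * T (delta y) x"
      using bounded_ops_add[OF T chi_in_ell2[OF g]] bounded_ops_scale[OF T dl] by simp
    then show ?case using insert 0[of y] by (auto simp: matrix_entry_def)
  qed
  obtain C where C: "0 \<le> C" "\<And>f. f \<in> ell2 X \<Longrightarrow> ell2_norm X (T f) \<le> C * ell2_norm X f"
    using bounded_opsE[OF T] by blast
  have le: "cmod (T g x) \<le> C * e" if e: "0 < e" for e
  proof -
    obtain F where F: "finite F" "F \<subseteq> X"
      "dist (\<Sum>x\<in>F. (cmod (g x))\<^sup>2) (\<Sum>\<^sub>\<infinity>x\<in>X. (cmod (g x))\<^sup>2) \<le> e\<^sup>2"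
      using infsum_finite_approximation[OF ell2_summable[OF g], of "e\<^sup>2"] e by auto
    \<comment> \<open>The tail of \<open>g\<close> off \<open>F\<close> has norm at most
      \<open>e\<close>, and boundedness of \<open>T\<close> carries this over to the value at
      \<open>x\<close>; the part on \<open>F\<close> contributes 0.\<close>
    define h where "h = chi (- F) g"
    have h: "h \<in> ell2 X" unfolding h_def by (rule chi_in_ell2[OF g])
    have "ell2_norm X h \<le> e"
    proof (rule ell2I_finite_sums(2))
      fix G assume G: "finite G" "G \<subseteq> X"
      have "(\<Sum>x\<in>G. (cmod (h x))\<^sup>2) = (\<Sum>x\<in>G-F. (cmod (g x))\<^sup>2)"
        using G by (intro sum.mono_neutral_cong_right) (auto simp: h_def chi_def)
      also have "\<dots> = (\<Sum>x\<in>G\<union>F. (cmod (g x))\<^sup>2) - (\<Sum>x\<in>F. (cmod (g x))\<^sup>2)"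
        using sum.subset_diff[of F "G \<union> F" "\<lambda>x. (cmod (g x))\<^sup>2"] G F by (simp add: Un_Diff)
      also have "\<dots> \<le> e\<^sup>2"
        using F sum_le_ell2_norm_square[OF g, of "G \<union> F"] G
        by (simp add: ell2_norm_square dist_real_def)
      finally show "(\<Sum>x\<in>G. (cmod (h x))\<^sup>2) \<le> e\<^sup>2" .
    qed (use e h in \<open>auto simp: ell2_def\<close>)
    then have "ell2_norm X (T h) \<le> C * e" using C h by (meson mult_left_mono order_trans)
    then have "cmod (T h x) \<le> C * e"
      using norm_le_ell2_norm[OF bounded_ops_closed[OF T h] x] by linarith
    moreover have "g = (\<lambda>x. chi F g x + h x)" by (auto simp: h_def chi_def)
    then have "T g x = T (chi F g) x + T h x"
      using bounded_ops_add[OF T chi_in_ell2[OF g, of F] h] by metis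
    ultimately show ?thesis using fin F by simp
  qed
  have "cmod (T g x) \<le> 0 + e" if "0 < e" for e
  proof -
    \<comment> \<open>Dividing by \<open>C + 1\<close> rather than \<open>C\<close> also covers
      \<open>C = 0\<close>.\<close>
    have "cmod (T g x) \<le> C * (e / (C + 1))" using C that by (intro le) auto
    also have "\<dots> \<le> e" using C that by (simp add: field_simps)
    finally show ?thesis by simp
  qed
  then have "cmod (T g x) \<le> 0" by (rule field_le_epsilon)
  then show ?thesis by simp
qed

section \<open>Boundaries of finite sets, and quasi-locality of the uniform Roe algebra\<close>

lemma set_distance_ge_iff: "ereal r \<le> set_distance d A B \<longleftrightarrow> (\<forall>a\<in>A. \<forall>b\<in>B. r \<le> d a b)"
  by (simp add: set_distance_def le_INF_iff)

lemma outer_boundary_finite: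
  assumes "finite A"
  shows "outer_boundary M d R A = {x\<in>M-A. \<exists>a\<in>A. d x a \<le> R}"
proof -
  have "set_distance d {x} A \<le> ereal R \<longleftrightarrow> (\<exists>a\<in>A. d x a \<le> R)" for x
  proof (cases "A = {}")
    case True
    then show ?thesis by (simp add: set_distance_def top_ereal_def)
  next
    case False
    have "set_distance d {x} A = Min ((\<lambda>a. ereal (d x a)) ` A)"
      using assms False by (simp add: set_distance_def cInf_eq_Min)
    then show ?thesis using assms False by (simp add: Min_le_iff)
  qed
  then show ?thesis by (simp add: outer_boundary_def)
qed

text \<open>Between sets farther apart than the propagation of \<open>S\<close>, the compression of
  \<open>S\<close> vanishes, so that of \<open>T\<close> equals that of \<open>T - S\<close> and is
  bounded by the approximation error.\<close>

lemma uniform_Roe_subset_quasi_local: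
  "uniform_Roe_algebra X D \<subseteq> uniform_quasi_local_algebra X D"
proof
  fix T assume "T \<in> uniform_Roe_algebra X D"
  then have T: "T \<in> bounded_ops X"
    and approx: "\<And>e. 0 < e \<Longrightarrow> \<exists>S\<in>bounded_ops X. finite_propagation X D S \<and> op_norm X (\<lambda>f x. T f x - S f x) < e"
    by (auto simp: uniform_Roe_algebra_def)
  have "quasi_local X D T"
    unfolding quasi_local_def
  proof (intro allI impI)
    fix e :: real assume "0 < e"
    then obtain S where S: "S \<in> bounded_ops X" "finite_propagation X D S"
      and less: "op_norm X (\<lambda>f x. T f x - S f x) < e" using approx by blast
    then obtain R where R: "0 < R" "\<And>x y. x \<in> X \<Longrightarrow> y \<in> X \<Longrightarrow> R < D x y \<Longrightarrow> matrix_entry S x y = 0"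
      unfolding finite_propagation_def by blast
    obtain C C' where C: "0 \<le> C" "\<And>f. f \<in> ell2 X \<Longrightarrow> ell2_norm X (T f) \<le> C * ell2_norm X f"
      and C': "0 \<le> C'" "\<And>f. f \<in> ell2 X \<Longrightarrow> ell2_norm X (S f) \<le> C' * ell2_norm X f"
      using bounded_opsE[OF T] bounded_opsE[OF S(1)] by metis
    have bd: "ell2_norm X (\<lambda>x. T f x - S f x) \<le> 2 * (C + C')" if f: "f \<in> ell2 X" "ell2_norm X f \<le> 1" for f
    proof -
      have "ell2_norm X (\<lambda>x. T f x - S f x) \<le> 2 * (ell2_norm X (T f) + ell2_norm X (S f))"
        by (intro ell2_diff bounded_ops_closed[OF T] bounded_ops_closed[OF S(1)] f)
      moreover have "C * ell2_norm X f \<le> C * 1" "C' * ell2_norm X f \<le> C' * 1"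
        using mult_left_mono[OF f(2) C(1)] mult_left_mono[OF f(2) C'(1)] by auto
      ultimately show ?thesis using C(2)[OF f(1)] C'(2)[OF f(1)] by simp
    qed
    show "\<exists>R>0. \<forall>A B. A \<subseteq> X \<and> B \<subseteq> X \<and> ereal R \<le> set_distance D A B \<longrightarrow>
        op_norm X (\<lambda>f. chi A (T (chi B f))) \<le> e"
    \<comment> \<open>Entries of \<open>S\<close> vanish only strictly above distance
      \<open>R\<close>, while the separation of \<open>A\<close> and \<open>B\<close> is a weak
      inequality; hence the extra 1.\<close>
    proof (intro exI[of _ "R + 1"] conjI allI impI)
      show "0 < R + 1" using R by simp
      fix A B assume AB: "A \<subseteq> X \<and> B \<subseteq> X \<and> ereal (R + 1) \<le> set_distance D A B"
      show "op_norm X (\<lambda>f. chi A (T (chi B f))) \<le> e"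
      proof (rule op_norm_le)
        fix f assume f: "f \<in> ell2 X" "ell2_norm X f \<le> 1"
        let ?g = "chi B f"
        have g: "?g \<in> ell2 X" "ell2_norm X ?g \<le> 1"
          using chi_in_ell2[OF f(1)] ell2_norm_chi_le[OF f(1), of B] f(2) by auto
        have "S ?g x = 0" if "x \<in> A" for x
        proof (rule bounded_op_eq_0_of_entries[OF S(1) g(1)])
          show "x \<in> X" using that AB by blast
          fix y assume "y \<in> X" "?g y \<noteq> 0"
          then have "R + 1 \<le> D x y" using AB that by (auto simp: set_distance_ge_iff chi_def split: if_splits)
          then show "matrix_entry S x y = 0" using R \<open>x \<in> X\<close> \<open>y \<in> X\<close> by simp
        qed
        then have eq: "chi A (T ?g) = chi A (\<lambda>x. T ?g x - S ?g x)" by (auto simp: chi_def)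
        have "ell2_norm X (chi A (T ?g)) \<le> ell2_norm X (\<lambda>x. T ?g x - S ?g x)"
          unfolding eq by (intro ell2_norm_chi_le ell2_diff bounded_ops_closed[OF T] bounded_ops_closed[OF S(1)] g)
        also have "\<dots> \<le> op_norm X (\<lambda>f x. T f x - S f x)"
          using bd g by (rule ell2_norm_le_op_norm)
        finally show "ell2_norm X (chi A (T ?g)) \<le> e" using less by simp
      qed
    qed
  qed
  then show "T \<in> uniform_quasi_local_algebra X D" using T by (simp add: uniform_quasi_local_algebra_def)
qed

section \<open>Direct sums of operators over the blocks\<close>

definition block_op ::
  "(nat \<Rightarrow> 'a set) \<Rightarrow> (nat \<Rightarrow> ('a \<Rightarrow> complex) \<Rightarrow> 'a \<Rightarrow> complex) \<Rightarrow> (nat \<times> 'a \<Rightarrow> complex) \<Rightarrow> nat \<times> 'a \<Rightarrow> complex" where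
  "block_op M T = restrict (\<lambda>f (n, x). if x \<in> M n then T n (\<lambda>y. f (n, y)) x else 0) (ell2 (Sigma UNIV M))"

text \<open>A finite set of points meets finitely many blocks and can be enlarged to the union of
  these whole blocks, where the hypothesis applies with the same \<open>B\<close>
  throughout.\<close>

lemma block_sum_bound:
  fixes g f :: "nat \<times> 'a \<Rightarrow> complex"
  assumes fin: "\<And>n. finite (M n)" and f: "f \<in> ell2 (Sigma UNIV M)" and B: "0 \<le> B"
    and supp: "\<And>z. z \<notin> Sigma UNIV M \<Longrightarrow> g z = 0"
    and le: "\<And>n. (\<Sum>x\<in>M n. (cmod (g (n, x)))\<^sup>2) \<le> B\<^sup>2 * (\<Sum>x\<in>M n. (cmod (f (n, x)))\<^sup>2)"
  shows "g \<in> ell2 (Sigma UNIV M)" and "ell2_norm (Sigma UNIV M) g \<le> B * ell2_norm (Sigma UNIV M) f"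
proof -
  let ?X = "Sigma UNIV M"
  have "(\<Sum>z\<in>F. (cmod (g z))\<^sup>2) \<le> (B * ell2_norm ?X f)\<^sup>2" if F: "finite F" "F \<subseteq> ?X" for F
  proof -
    let ?G = "Sigma (fst ` F) M"
    have G: "finite ?G" "F \<subseteq> ?G" "?G \<subseteq> ?X" using F fin by force+
    have "(\<Sum>z\<in>F. (cmod (g z))\<^sup>2) \<le> (\<Sum>z\<in>?G. (cmod (g z))\<^sup>2)"
      using G by (intro sum_mono2) auto
    also have "\<dots> = (\<Sum>n\<in>fst ` F. \<Sum>x\<in>M n. (cmod (g (n, x)))\<^sup>2)"
      using F fin by (subst sum.Sigma) auto
    also have "\<dots> \<le> (\<Sum>n\<in>fst ` F. B\<^sup>2 * (\<Sum>x\<in>M n. (cmod (f (n, x)))\<^sup>2))"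
      by (intro sum_mono le)
    also have "\<dots> = B\<^sup>2 * (\<Sum>n\<in>fst ` F. \<Sum>x\<in>M n. (cmod (f (n, x)))\<^sup>2)"
      by (simp add: sum_distrib_left)
    also have "(\<Sum>n\<in>fst ` F. \<Sum>x\<in>M n. (cmod (f (n, x)))\<^sup>2) = (\<Sum>z\<in>?G. (cmod (f z))\<^sup>2)"
      using F fin by (subst sum.Sigma) auto
    also have "B\<^sup>2 * \<dots> \<le> B\<^sup>2 * (ell2_norm ?X f)\<^sup>2"
      using G f by (intro mult_left_mono sum_le_ell2_norm_square) auto
    finally show ?thesis by (simp add: power_mult_distrib)
  qed
  then show "g \<in> ell2 ?X" "ell2_norm ?X g \<le> B * ell2_norm ?X f"
    using ell2I_finite_sums[of ?X g "B * ell2_norm ?X f"] supp B by simp_all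
qed

lemma block_op_bounded:
  assumes fin: "\<And>n. finite (M n)" and B: "0 \<le> B"
    and add: "\<And>n f g. T n (\<lambda>x. f x + g x) = (\<lambda>x. T n f x + T n g x)"
    and scale: "\<And>n c f. T n (\<lambda>x. c * f x) = (\<lambda>x. c * T n f x)"
    and le: "\<And>n f. (\<Sum>x\<in>M n. (cmod (T n f x))\<^sup>2) \<le> B\<^sup>2 * (\<Sum>x\<in>M n. (cmod (f x))\<^sup>2)"
  shows "block_op M T \<in> bounded_ops (Sigma UNIV M)"
proof -
  let ?X = "Sigma UNIV M"
  have *: "block_op M T f \<in> ell2 ?X \<and> ell2_norm ?X (block_op M T f) \<le> B * ell2_norm ?X f" if "f \<in> ell2 ?X" for f
    using block_sum_bound[OF fin that B, of "block_op M T f"] that le by (auto simp: block_op_def)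
  have sum: "(\<lambda>x. f x + g x) \<in> ell2 ?X" if "f \<in> ell2 ?X" "g \<in> ell2 ?X" for f g
    using ell2_diff(1)[OF that(1) ell2_dominated(1)[OF that(2), of "\<lambda>x. - g x"]] by simp
  have mult: "(\<lambda>x. c * f x) \<in> ell2 ?X" if "f \<in> ell2 ?X" for f c
    by (rule block_sum_bound(1)[OF fin that, of "cmod c"])
      (use that in \<open>auto simp: ell2_def norm_mult power_mult_distrib sum_distrib_left\<close>)
  show ?thesis
    unfolding bounded_ops_def
  proof (intro CollectI conjI)
    show "block_op M T \<in> ell2 ?X \<rightarrow>\<^sub>E ell2 ?X" using * by (auto simp: block_op_def)
    show "\<forall>f\<in>ell2 ?X. \<forall>g\<in>ell2 ?X. block_op M T (\<lambda>x. f x + g x) = (\<lambda>x. block_op M T f x + block_op M T g x)"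
      by (auto simp: block_op_def sum add)
    show "\<forall>c. \<forall>f\<in>ell2 ?X. block_op M T (\<lambda>x. c * f x) = (\<lambda>x. c * block_op M T f x)"
      by (auto simp: block_op_def mult scale)
    show "\<exists>C. \<forall>f\<in>ell2 ?X. ell2_norm ?X (block_op M T f) \<le> C * ell2_norm ?X f" using * by blast
  qed
qed

lemma averaging_projection_eq_block_op:
  "averaging_projection M = block_op M (\<lambda>n f _. mean (M n) f)"
  by (simp add: averaging_projection_def block_op_def mean_def)

lemma averaging_projection_bounded:
  assumes "\<And>n. finite (M n)"
  shows "averaging_projection M \<in> bounded_ops (Sigma UNIV M)"
  unfolding averaging_projection_eq_block_op
  by (rule block_op_bounded[OF assms, of 1])
    (simp_all add: norm_mean_square_le assms, simp_all add: mean_def sum.distrib add_divide_distrib sum_distrib_left)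

section \<open>Asymptotic expanders\<close>

text \<open>
  Removing a largest set with small boundary leaves a genuine expander: a set with small boundary
  in the remainder could be added to the removed one, and then either contradict maximality or, if
  the union exceeds half of the space, produce a poorly expanding set on the other side.
\<close>

lemma expander_core_exists:
  fixes \<alpha> c R :: real
  assumes "Metric_space X d" and fin: "finite X" and ne: "X \<noteq> {}"
    and \<alpha>: "0 < \<alpha>" "\<alpha> \<le> 1/8" and c: "0 < c" "c < 1"
    and hyp: "\<And>A. A \<subseteq> X \<Longrightarrow> \<alpha> * card X \<le> card A \<Longrightarrow> card A \<le> 1/2 * card X
      \<Longrightarrow> card (outer_boundary X d R A) > c * card A"
  obtains Y where "Y \<subseteq> X" "Y \<noteq> {}" "card (X - Y) \<le> \<alpha> * card X"
    "\<And>B. B \<subseteq> Y \<Longrightarrow> 2 * card B \<le> card Y \<Longrightarrow> c * \<alpha> * card B \<le> card {y\<in>Y-B. \<exists>b\<in>B. d y b \<le> R}"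
proof -
  interpret Metric_space X d by fact
  define bd where "bd A = {x\<in>X-A. \<exists>a\<in>A. d x a \<le> R}" for A
  have hyp': "c * card A < card (bd A)" if "A \<subseteq> X" "\<alpha> * card X \<le> card A" "card A \<le> 1/2 * card X" for A
    using hyp[OF that] finite_subset[OF that(1) fin] by (simp add: outer_boundary_finite bd_def)
  define n where "n = real (card X)"
  have n: "0 < n" using fin ne by (simp add: n_def card_gt_0_iff)
  \<comment> \<open>The threshold is \<open>c * \<alpha>\<close> rather than \<open>c\<close>, so
    that a set with at least \<open>\<alpha> * n\<close> points and at most half of the space has a
    boundary exceeding that of any \<open>C\<close> with
    \<open>card (bd C) \<le> c * \<alpha> * n\<close>; the last case below turns on this.\<close>
  define Bad where "Bad = {A. A \<subseteq> X \<and> card A \<le> 1/2 * n \<and> card (bd A) \<le> c * \<alpha> * card A}"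
  have finBad: "finite (card ` Bad)" using fin by (simp add: Bad_def)
  have "{} \<in> Bad" using n by (simp add: Bad_def bd_def)
  then have "Max (card ` Bad) \<in> card ` Bad" using finBad by (intro Max_in) auto
  then obtain A where A: "A \<in> Bad" and "card A = Max (card ` Bad)" by auto
  then have max: "card B \<le> card A" if "B \<in> Bad" for B using finBad that by simp
  have A': "A \<subseteq> X" "card A \<le> 1/2 * n" "card (bd A) \<le> c * \<alpha> * card A" "finite A"
    using A finite_subset[OF _ fin] by (auto simp: Bad_def)
  have small: "card A < \<alpha> * n"
  proof (rule ccontr)
    assume "\<not> ?thesis"
    then have "c * card A < card (bd A)" using A' by (intro hyp') (auto simp: n_def)
    moreover have "c * \<alpha> * card A \<le> c * 1 * card A"
      using \<alpha> c by (intro mult_right_mono mult_left_mono) auto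
    ultimately show False using A' by simp
  qed
  define Y where "Y = X - A"
  have cY: "real (card Y) = n - card A"
    using A' fin by (simp add: Y_def n_def card_Diff_subset card_mono)
  have XY: "X - Y = A" using A' by (auto simp: Y_def)
  show ?thesis
  proof (rule that[of Y])
    show "Y \<subseteq> X" by (auto simp: Y_def)
    have "\<alpha> * n \<le> 1 * n" using n \<alpha> by (intro mult_right_mono) auto
    then have "0 < card Y" using cY small by linarith
    then show "Y \<noteq> {}" by auto
    show "card (X - Y) \<le> \<alpha> * card X" using small by (simp add: XY n_def)
    fix B assume B: "B \<subseteq> Y" "2 * card B \<le> card Y"
    let ?bB = "{y\<in>Y-B. \<exists>b\<in>B. d y b \<le> R}"
    have finB: "finite B" "finite ?bB" using B fin finite_subset by (auto simp: Y_def)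
    show "c * \<alpha> * card B \<le> card ?bB"
    proof (rule ccontr)
      assume "\<not> ?thesis"
      then have less: "card ?bB < c * \<alpha> * card B" by simp
      then have B0: "0 < card B" by (cases "card B = 0") auto
      define C where "C = A \<union> B"
      have C: "C \<subseteq> X" "finite C" using A' B finB by (auto simp: C_def Y_def)
      have cC: "card C = card A + card B"
        using A' finB B by (auto simp: C_def Y_def intro!: card_Un_disjoint)
      have "bd C \<subseteq> bd A \<union> ?bB" by (auto simp: bd_def C_def Y_def)
      then have "card (bd C) \<le> card (bd A \<union> ?bB)" using fin finB by (intro card_mono) (auto simp: bd_def)
      also have "\<dots> \<le> card (bd A) + card ?bB" by (rule card_Un_le)
      finally have bC: "card (bd C) \<le> c * \<alpha> * card C"
        using A' less by (simp add: cC algebra_simps)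
      show False
      proof (cases "card C \<le> 1/2 * n")
        case True
        then have "C \<in> Bad" using C bC by (simp add: Bad_def)
        then show False using max[of C] B0 by (simp add: cC)
      next
        case False
        \<comment> \<open>The other side of \<open>C\<close>: the points farther than
          \<open>R\<close> from it. It is at most half of the space because \<open>C\<close> exceeds
          half.\<close>
        define E where "E = X - (C \<union> bd C)"
        have E: "E \<subseteq> X" "finite E" using fin by (auto simp: E_def)
        have "card C \<le> n" using card_mono[OF fin C(1)] by (simp add: n_def)
        then have "c * \<alpha> * card C \<le> c * \<alpha> * n" using c \<alpha> by (intro mult_left_mono) auto
        then have bn: "card (bd C) \<le> c * (\<alpha> * n)" using bC by (simp add: mult.assoc)
        have "c * (\<alpha> * n) \<le> 1 * (\<alpha> * n)" using c \<alpha> n by (intro mult_right_mono) auto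
        then have bn': "card (bd C) \<le> \<alpha> * n" using bn by linarith
        have "C \<inter> bd C = {}" "C \<union> bd C \<subseteq> X" using C by (auto simp: bd_def)
        then have cE: "real (card E) = n - card C - card (bd C)"
          using C fin card_mono[OF fin, of "C \<union> bd C"]
          by (simp add: E_def card_Diff_subset finite_subset card_Un_disjoint n_def)
        have \<alpha>n: "\<alpha> * n \<le> 1/8 * n" using \<alpha> n by (intro mult_right_mono) auto
        have "2 * real (card B) \<le> real (card Y)" using B(2) by linarith
        then have "card C \<le> (n + card A) / 2" using cY by (simp add: cC)
        \<comment> \<open>Both \<open>card A\<close> and \<open>card (bd C)\<close> are at most
          \<open>\<alpha> * n\<close>, and \<alpha> is at most 1/8, so the right side is at least
          5/8 of \<open>n\<close>; this is well above \<open>2 * \<alpha> * n\<close>.\<close>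
        then have "2 * real (card E) \<ge> n - card A - 2 * (\<alpha> * n)" using cE bn' by argo
        then have Eal: "\<alpha> * n \<le> card E" using \<alpha>n small n by argo
        have "card E \<le> 1/2 * n" using cE False by linarith
        then have *: "c * card E < card (bd E)" using E Eal by (intro hyp') (auto simp: n_def)
        \<comment> \<open>By symmetry of the distance: a point of \<open>C\<close> within
          \<open>R\<close> of some \<open>e\<close> in \<open>E\<close> would put \<open>e\<close>
          into \<open>bd C\<close>, which \<open>E\<close> avoids.\<close>
        have "bd E \<subseteq> bd C"
        proof
          fix x assume "x \<in> bd E"
          then obtain e where e: "x \<in> X" "x \<notin> E" "e \<in> E" "d x e \<le> R" by (auto simp: bd_def)
          show "x \<in> bd C"
          proof (rule ccontr)
            assume "x \<notin> bd C"
            then have "x \<in> C" using e by (auto simp: E_def)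
            then have "e \<in> bd C" using e commute[of e x] by (auto simp: bd_def E_def)
            then show False using e by (simp add: E_def)
          qed
        qed
        then have "card (bd E) \<le> card (bd C)" using fin by (intro card_mono) (auto simp: bd_def)
        moreover have "c * (\<alpha> * n) \<le> c * card E" using Eal c by (intro mult_left_mono) auto
        ultimately show False using * bn by linarith
      qed
    qed
  qed
qed

text \<open>Each boundary vertex receives at least one edge from \<open>B\<close>, so vertex
  expansion bounds the cut weight from below, and ball sizes bound the degrees. \<open>Suc N\<close>
  ensures that the degree constant is at least 1.\<close>

lemma expander_graph_of_metric:
  fixes c R :: real
  assumes "Metric_space X d" "Y \<subseteq> X" "finite X" "0 < c" "c \<le> 1"
    and N: "\<And>x. x \<in> X \<Longrightarrow> card (Metric_space.mcball X d x R) \<le> N"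
    and ex: "\<And>B. B \<subseteq> Y \<Longrightarrow> 2 * card B \<le> card Y \<Longrightarrow> c * card B \<le> card {y\<in>Y-B. \<exists>b\<in>B. d y b \<le> R}"
  shows "expander_graph Y (\<lambda>x y. of_bool (d x y \<le> R)) (real (Suc N)) c"
proof -
  interpret Metric_space X d by fact
  have finY: "finite Y" using assms finite_subset by blast
  show ?thesis
  proof unfold_locales
    fix x assume x: "x \<in> Y"
    have "card {y\<in>Y. d x y \<le> R} \<le> card (mcball x R)"
      using assms x by (intro card_mono) (auto simp: mcball_def)
    then have "card {y\<in>Y. d x y \<le> R} \<le> N" using N[of x] x assms(2) by auto
    then show "(\<Sum>y\<in>Y. of_bool (d x y \<le> R)) \<le> real (Suc N)"
      using finY by (simp add: Int_def)
  next
    fix B assume B: "B \<subseteq> Y" "2 * card B \<le> card Y"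
    have finB: "finite B" using B finY finite_subset by blast
    have "c * card B \<le> card {y\<in>Y-B. \<exists>b\<in>B. d y b \<le> R}" by (rule ex[OF B])
    also have "\<dots> = (\<Sum>y\<in>Y-B. of_bool (\<exists>b\<in>B. d y b \<le> R))"
      using finY by (simp add: Int_def)
    also have "\<dots> \<le> (\<Sum>y\<in>Y-B. \<Sum>x\<in>B. of_bool (d x y \<le> R))"
    proof (intro sum_mono)
      fix y assume "y \<in> Y - B"
      show "of_bool (\<exists>b\<in>B. d y b \<le> R) \<le> (\<Sum>x\<in>B. of_bool (d x y \<le> R) :: real)"
      proof (cases "\<exists>b\<in>B. d y b \<le> R")
        case True
        then obtain b where b: "b \<in> B" "d b y \<le> R" by (auto simp: commute)
        then show ?thesis
          using member_le_sum[OF b(1), of "\<lambda>x. of_bool (d x y \<le> R) :: real"] finB by simp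
      qed (simp add: sum_nonneg)
    qed
    also have "\<dots> = (\<Sum>x\<in>B. \<Sum>y\<in>Y-B. of_bool (d x y \<le> R))" by (rule sum.swap)
    finally show "c * card B \<le> (\<Sum>x\<in>B. \<Sum>y\<in>Y-B. of_bool (d x y \<le> R))" .
  qed (use assms finY commute in auto)
qed

text \<open>Two errors are added: replacing the mean of \<open>X\<close> by that of
  \<open>Y\<close>, and replacing the latter by \<open>k\<close> steps of the walk. Splitting the
  square doubles both.\<close>

lemma (in expander_graph) norm_mean_minus_diffusion_pow_le:
  fixes \<alpha> :: real
  assumes X: "finite X" "Y \<subseteq> X" "Y \<noteq> {}" "card (X - Y) \<le> \<alpha> * card X"
  shows "(\<Sum>x\<in>X. (cmod (mean X f - (diffusion Y w K ^^ k) (chi Y f) x))\<^sup>2)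
    \<le> (8 * \<alpha> + 2 * rate ^ k) * (\<Sum>x\<in>X. (cmod (f x))\<^sup>2)"
proof -
  let ?W = "(diffusion Y w K ^^ k) (chi Y f)" and ?m = "chi Y (\<lambda>_. mean Y f)"
  have W0: "?W x = 0" if "x \<notin> Y" for x
    using that by (intro diffusion_pow_outside) (simp_all add: chi_def)
  have "(\<Sum>x\<in>X. (cmod (?m x - ?W x))\<^sup>2) = (\<Sum>x\<in>Y. (cmod (?W x - mean Y f))\<^sup>2)"
    using X W0 by (intro sum.mono_neutral_cong_right) (auto simp: chi_def norm_minus_commute)
  also have "\<dots> \<le> rate ^ k * (\<Sum>x\<in>Y. (cmod (f x))\<^sup>2)" by (rule norm_diffusion_pow_minus_mean_le)
  also have "\<dots> \<le> rate ^ k * (\<Sum>x\<in>X. (cmod (f x))\<^sup>2)"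
    using X rate_nonneg by (intro mult_left_mono sum_mono2) auto
  finally have 1: "(\<Sum>x\<in>X. (cmod (?m x - ?W x))\<^sup>2) \<le> rate ^ k * (\<Sum>x\<in>X. (cmod (f x))\<^sup>2)" .
  have "(\<Sum>x\<in>X. (cmod (mean X f - ?W x))\<^sup>2)
      \<le> (\<Sum>x\<in>X. 2 * (cmod (mean X f - ?m x))\<^sup>2 + 2 * (cmod (?m x - ?W x))\<^sup>2)"
    using norm_add_square_le[of "mean X f - ?m x" "?m x - ?W x" for x] by (intro sum_mono) simp
  also have "\<dots> = 2 * (\<Sum>x\<in>X. (cmod (mean X f - ?m x))\<^sup>2) + 2 * (\<Sum>x\<in>X. (cmod (?m x - ?W x))\<^sup>2)"
    by (simp add: sum.distrib sum_distrib_left)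
  also have "\<dots> \<le> 2 * (4 * \<alpha> * (\<Sum>x\<in>X. (cmod (f x))\<^sup>2)) + 2 * (rate ^ k * (\<Sum>x\<in>X. (cmod (f x))\<^sup>2))"
    using 1 norm_mean_minus_mean_subset_le[OF X, of f] by linarith
  finally show ?thesis by (simp add: algebra_simps)
qed

section \<open>Approximation of the averaging projection by operators of finite propagation\<close>

lemma averaging_projection_in_uniform_Roe_algebra:
  assumes metric: "\<And>n. Metric_space (M n) (d n)" and fin: "\<And>n. finite (M n)" and ne: "\<And>n. M n \<noteq> {}"
    and ubg: "uniformly_bounded_geometry M d" and cdu: "coarse_disjoint_union M d D"
    and ae: "asymptotic_expanders M d"
  shows "averaging_projection M \<in> uniform_Roe_algebra (Sigma UNIV M) D"
proof -
  let ?X = "Sigma UNIV M" and ?P = "averaging_projection M"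
  have P: "?P \<in> bounded_ops ?X" by (rule averaging_projection_bounded[OF fin])
  have "\<exists>S\<in>bounded_ops ?X. finite_propagation ?X D S \<and> op_norm ?X (\<lambda>f x. ?P f x - S f x) < \<epsilon>"
    if \<epsilon>: "0 < \<epsilon>" for \<epsilon> :: real
  proof -
    \<comment> \<open>The core lemma asks for 1/8. The other bound gives
      \<open>8 * \<alpha> \<le> \<epsilon>\<^sup>2 / 8\<close>, and the choice of \<open>k\<close>
      below makes \<open>2 * ?r ^ k\<close> less than the same amount; together they stay below the
      square of \<open>\<epsilon> / 2\<close>.\<close>
    define \<alpha> where "\<alpha> = min (1/8) (\<epsilon>\<^sup>2 / 64)"
    have \<alpha>: "0 < \<alpha>" "\<alpha> \<le> 1/8" "\<alpha> \<le> \<epsilon>\<^sup>2 / 64" using \<epsilon> by (auto simp: \<alpha>_def)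
    obtain c R :: real where c: "0 < c" "c < 1" and R: "0 < R"
      and hyp: "\<And>n A. A \<subseteq> M n \<Longrightarrow> \<alpha> * card (M n) \<le> card A \<Longrightarrow> card A \<le> 1/2 * card (M n)
        \<Longrightarrow> card (outer_boundary (M n) (d n) R A) > c * card A"
    proof -
      have "0 < \<alpha> \<and> \<alpha> \<le> 1/2" using \<alpha> by simp
      then show ?thesis using ae that unfolding asymptotic_expanders_def by meson
    qed
    obtain N where N: "\<And>n x. x \<in> M n \<Longrightarrow> card (Metric_space.mcball (M n) (d n) x R) \<le> N"
      using ubg R unfolding uniformly_bounded_geometry_def by blast
    define K where "K = real (Suc N)"
    define w where "w n x y = (of_bool (d n x y \<le> R) :: real)" for n x y
    have "\<exists>Y. Y \<subseteq> M n \<and> Y \<noteq> {} \<and> card (M n - Y) \<le> \<alpha> * card (M n) \<and> expander_graph Y (w n) K (c * \<alpha>)" for n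
    proof (rule expander_core_exists[OF metric[of n] fin ne \<alpha>(1,2) c hyp])
      fix Y assume Y: "Y \<subseteq> M n" "Y \<noteq> {}" "card (M n - Y) \<le> \<alpha> * card (M n)"
        "\<And>B. B \<subseteq> Y \<Longrightarrow> 2 * card B \<le> card Y \<Longrightarrow> c * \<alpha> * card B \<le> card {y\<in>Y-B. \<exists>b\<in>B. d n y b \<le> R}"
      have "c * \<alpha> \<le> 1" using c \<alpha> by (simp add: mult_le_one)
      then have "expander_graph Y (w n) K (c * \<alpha>)"
        unfolding w_def K_def using c \<alpha> Y by (intro expander_graph_of_metric[OF metric _ fin] N) auto
      then show "\<exists>Y. Y \<subseteq> M n \<and> Y \<noteq> {} \<and> card (M n - Y) \<le> \<alpha> * card (M n)
          \<and> expander_graph Y (w n) K (c * \<alpha>)"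
        using Y by blast
    qed
    then obtain Y where Y: "\<And>n. Y n \<subseteq> M n" "\<And>n. Y n \<noteq> {}" "\<And>n. card (M n - Y n) \<le> \<alpha> * card (M n)"
      and eg: "\<And>n. expander_graph (Y n) (w n) K (c * \<alpha>)" by metis
    \<comment> \<open>No block index occurs in this rate, so a single \<open>k\<close> works for all
      \<open>n\<close>.\<close>
    let ?r = "expander_graph.rate K (c * \<alpha>)"
    have r: "0 \<le> ?r" "?r < 1"
      using expander_graph.rate_nonneg[OF eg] expander_graph.rate_less_1[OF eg] by blast+
    obtain k where k: "?r ^ k < \<epsilon>\<^sup>2 / 16" using real_arch_pow_inv[of "\<epsilon>\<^sup>2 / 16" ?r] \<epsilon> r by auto
    define T where "T n f = (diffusion (Y n) (w n) K ^^ k) (chi (Y n) f)" for n f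
    have T0: "T n f x = 0" if "x \<notin> Y n" for n f x
      unfolding T_def using that by (intro diffusion_pow_outside) (simp_all add: chi_def)
    have close: "(\<Sum>x\<in>M n. (cmod (mean (M n) f - T n f x))\<^sup>2) \<le> (\<epsilon> / 2)\<^sup>2 * (\<Sum>x\<in>M n. (cmod (f x))\<^sup>2)" for n f
    proof -
      have "(\<Sum>x\<in>M n. (cmod (mean (M n) f - T n f x))\<^sup>2) \<le> (8 * \<alpha> + 2 * ?r ^ k) * (\<Sum>x\<in>M n. (cmod (f x))\<^sup>2)"
        unfolding T_def by (rule expander_graph.norm_mean_minus_diffusion_pow_le[OF eg fin Y])
      also have "\<dots> \<le> (\<epsilon> / 2)\<^sup>2 * (\<Sum>x\<in>M n. (cmod (f x))\<^sup>2)"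
        using k \<alpha>(3) by (intro mult_right_mono sum_nonneg) (auto simp: power2_eq_square)
      finally show ?thesis .
    qed
    define S where "S = block_op M T"
    have S: "S \<in> bounded_ops ?X"
      unfolding S_def
    \<comment> \<open>The bound on \<open>T n\<close> is read off from its distance to the mean,
      which is itself a contraction.\<close>
    proof (rule block_op_bounded[OF fin, of "sqrt (2 + 2 * (\<epsilon> / 2)\<^sup>2)"])
      fix n f
      let ?N = "\<Sum>x\<in>M n. (cmod (f x))\<^sup>2"
      have "(\<Sum>x\<in>M n. (cmod (T n f x))\<^sup>2)
          \<le> (\<Sum>x\<in>M n. 2 * (cmod (mean (M n) f))\<^sup>2 + 2 * (cmod (mean (M n) f - T n f x))\<^sup>2)"
        using norm_add_square_le[of "mean (M n) f" "T n f x - mean (M n) f" for x]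
        by (intro sum_mono) (simp add: norm_minus_commute)
      also have "\<dots> = 2 * (card (M n) * (cmod (mean (M n) f))\<^sup>2)
          + 2 * (\<Sum>x\<in>M n. (cmod (mean (M n) f - T n f x))\<^sup>2)"
        by (simp add: sum.distrib sum_distrib_left)
      also have "\<dots> \<le> 2 * ?N + 2 * ((\<epsilon> / 2)\<^sup>2 * ?N)"
        using close[of n f] norm_mean_square_le[OF fin, of n f] by linarith
      also have "\<dots> = (2 + 2 * (\<epsilon> / 2)\<^sup>2) * ?N" by (simp add: algebra_simps)
      finally show "(\<Sum>x\<in>M n. (cmod (T n f x))\<^sup>2) \<le> (sqrt (2 + 2 * (\<epsilon> / 2)\<^sup>2))\<^sup>2 * ?N"
        by simp
    next
      fix n f g
      have "chi (Y n) (\<lambda>x. f x + g x) = (\<lambda>x. chi (Y n) f x + chi (Y n) g x)" by (auto simp: chi_def)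
      then show "T n (\<lambda>x. f x + g x) = (\<lambda>x. T n f x + T n g x)" by (simp add: T_def diffusion_pow_add)
    next
      fix n a f
      have "chi (Y n) (\<lambda>x. a * f x) = (\<lambda>x. a * chi (Y n) f x)" by (auto simp: chi_def)
      then show "T n (\<lambda>x. a * f x) = (\<lambda>x. a * T n f x)" by (simp add: T_def diffusion_pow_scale)
    qed simp
    moreover have "finite_propagation ?X D S"
      unfolding finite_propagation_def
    \<comment> \<open>The added 1 keeps the propagation bound positive when
      \<open>k = 0\<close>.\<close>
    proof (intro exI[of _ "real k * R + 1"] conjI ballI impI)
      show "0 < real k * R + 1" using R by (simp add: add_nonneg_pos)
      fix p q assume p: "p \<in> ?X" and q: "q \<in> ?X" and far: "real k * R + 1 < D p q"
      obtain n a where pna: "p = (n, a)" by (cases p)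
      have a: "a \<in> M n" using p pna by simp
      show "matrix_entry S p q = 0"
      proof (rule ccontr)
        assume "matrix_entry S p q \<noteq> 0"
        then have "T n (\<lambda>z. delta q (n, z)) a \<noteq> 0"
          using a delta_in_ell2[OF q] by (simp add: matrix_entry_def S_def block_op_def pna)
        then have "\<exists>z\<in>Y n. chi (Y n) (\<lambda>z. delta q (n, z)) z \<noteq> 0 \<and> d n a z \<le> real k * R"
          unfolding T_def
          by (rule diffusion_pow_support[OF _ metric Y(1)]) (use R in \<open>auto simp: chi_def w_def\<close>)
        then obtain z where z: "z \<in> Y n" "chi (Y n) (\<lambda>z. delta q (n, z)) z \<noteq> 0" "d n a z \<le> real k * R"
          by blast
        \<comment> \<open>A nonzero value forces \<open>q\<close> into the same block as
          \<open>p\<close>, so entries between different blocks vanish and only distances inside a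
          block matter.\<close>
        then have "q = (n, z)" by (auto simp: chi_def delta_def split: if_splits)
        moreover have "D (n, a) (n, z) = d n a z"
          using cdu a z Y(1) unfolding coarse_disjoint_union_def by blast
        ultimately show False using far z pna by simp
      qed
    qed
    moreover have "op_norm ?X (\<lambda>f x. ?P f x - S f x) \<le> \<epsilon> / 2"
    proof (rule op_norm_le)
      fix f assume f: "f \<in> ell2 ?X" "ell2_norm ?X f \<le> 1"
      have "ell2_norm ?X (\<lambda>x. ?P f x - S f x) \<le> \<epsilon> / 2 * ell2_norm ?X f"
      proof (rule block_sum_bound(2)[OF fin f(1)])
        fix n
        show "(\<Sum>x\<in>M n. (cmod (?P f (n, x) - S f (n, x)))\<^sup>2) \<le> (\<epsilon> / 2)\<^sup>2 * (\<Sum>x\<in>M n. (cmod (f (n, x)))\<^sup>2)"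
          using close[of n "\<lambda>x. f (n, x)"] f(1)
          by (simp add: S_def averaging_projection_eq_block_op block_op_def)
      qed (use \<epsilon> f(1) in \<open>auto simp: S_def averaging_projection_eq_block_op block_op_def split: if_splits\<close>)
      also have "\<dots> \<le> \<epsilon> / 2 * 1" using f(2) \<epsilon> by (intro mult_left_mono) auto
      finally show "ell2_norm ?X (\<lambda>x. ?P f x - S f x) \<le> \<epsilon> / 2" by simp
    qed
    ultimately show ?thesis using \<epsilon> by force
  qed
  then show ?thesis using P by (simp add: uniform_Roe_algebra_def)
qed

text \<open>
  If \<open>A\<close> has small \<open>R\<close>-boundary, then \<open>A\<close> and the set \<open>B\<close> of points farther than \<open>R\<close> from it
  both have positive density, and so \<open>\<chi>\<^sub>A P \<chi>\<^sub>B\<close> has norm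
  \<open>sqrt (card A * card B) / card (M n)\<close>, which is bounded below.
\<close>

lemma asymptotic_expanders_of_quasi_local:
  assumes metric: "\<And>n. Metric_space (M n) (d n)" and fin: "\<And>n. finite (M n)" and ne: "\<And>n. M n \<noteq> {}"
    and lim: "filterlim (\<lambda>n. card (M n)) at_top sequentially"
    and cdu: "coarse_disjoint_union M d D"
    and ql: "quasi_local (Sigma UNIV M) D (averaging_projection M)"
  shows "asymptotic_expanders M d"
proof -
  let ?X = "Sigma UNIV M" and ?P = "averaging_projection M"
  have P: "?P \<in> bounded_ops ?X" by (rule averaging_projection_bounded[OF fin])
  have "\<exists>(c::real) R. 0 < c \<and> c < 1 \<and> 0 < R \<and> (\<forall>n A. A \<subseteq> M n \<and> \<alpha> * card (M n) \<le> card A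
      \<and> card A \<le> 1/2 * card (M n) \<longrightarrow> card (outer_boundary (M n) (d n) R A) > c * card A)"
    if \<alpha>: "0 < \<alpha>" for \<alpha> :: real
  proof -
    \<comment> \<open>Half of \<open>sqrt \<alpha> / 2\<close>, the lower bound for the norm of the
      compression found below.\<close>
    define \<epsilon> where "\<epsilon> = sqrt \<alpha> / 4"
    have "0 < \<epsilon>" using \<alpha> by (simp add: \<epsilon>_def)
    then obtain R where R: "0 < R" and small: "\<And>A B. A \<subseteq> ?X \<Longrightarrow> B \<subseteq> ?X \<Longrightarrow> ereal R \<le> set_distance D A B
        \<Longrightarrow> op_norm ?X (\<lambda>f. chi A (?P (chi B f))) \<le> \<epsilon>"
      using ql unfolding quasi_local_def by meson
    have "card A / 2 < card (outer_boundary (M n) (d n) R A)"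
      if A: "A \<subseteq> M n" "\<alpha> * card (M n) \<le> card A" "card A \<le> 1/2 * card (M n)" for n A
    proof (rule ccontr)
      assume neg: "\<not> ?thesis"
      define bd where "bd = {x\<in>M n-A. \<exists>a\<in>A. d n x a \<le> R}"
      have finA: "finite A" using A fin finite_subset by blast
      have bd: "card bd \<le> card A / 2"
        using neg outer_boundary_finite[OF finA] by (simp add: bd_def)
      define B where "B = M n - (A \<union> bd)"
      define m where "m = real (card (M n))"
      \<comment> \<open>Nonemptiness of the blocks matters: in an empty block the empty set would
        violate the strict inequality.\<close>
      have m: "0 < m" using fin ne by (simp add: m_def card_gt_0_iff)
      have "A \<inter> bd = {}" "A \<union> bd \<subseteq> M n" "finite bd" using A fin by (auto simp: bd_def)
      then have "real (card B) = m - card A - card bd"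
        using finA card_mono[OF fin, of "A \<union> bd" n]
        by (simp add: B_def card_Diff_subset card_Un_disjoint m_def)
      \<comment> \<open>At most \<open>m / 2\<close> points lie in \<open>A\<close> and at most half
        as many in its boundary.\<close>
      then have cB: "m / 4 \<le> card B" using bd A by (simp add: m_def)
      then have B0: "0 < real (card B)" using m by linarith
      have finB: "finite B" using fin by (simp add: B_def)
      let ?A = "{n} \<times> A" and ?B = "{n} \<times> B"
      have "R \<le> D (n, a) (n, b)" if "a \<in> A" "b \<in> B" for a b
      proof -
        have "D (n, a) (n, b) = d n a b"
          using cdu that A unfolding coarse_disjoint_union_def B_def by blast
        moreover have "d n a b = d n b a" using Metric_space.commute[OF metric] by metis
        ultimately show ?thesis using that by (force simp: B_def bd_def)
      qed
      then have "op_norm ?X (\<lambda>f. chi ?A (?P (chi ?B f))) \<le> \<epsilon>"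
        using A by (intro small) (auto simp: set_distance_ge_iff B_def)
      \<comment> \<open>On the block the compression has rank one, and this normalised indicator of
        \<open>?B\<close> is the unit vector at which its norm is attained.\<close>
      define f where "f z = (if z \<in> ?B then complex_of_real (1 / sqrt (card B)) else 0)" for z
      have "(\<Sum>z\<in>F. (cmod (f z))\<^sup>2) \<le> 1\<^sup>2" if "finite F" for F
      proof -
        have "(\<Sum>z\<in>F. (cmod (f z))\<^sup>2) = (\<Sum>z\<in>F \<inter> ?B. 1 / card B)"
          using that by (intro sum.mono_neutral_cong_right) (auto simp: f_def norm_divide power_divide)
        also have "\<dots> \<le> (\<Sum>z\<in>?B. 1 / card B)" using finB by (intro sum_mono2) auto
        also have "\<dots> = 1" using B0 by (simp add: card_cartesian_product)
        finally show ?thesis by simp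
      qed
      moreover have "f z = 0" if "z \<notin> ?X" for z using that by (auto simp: f_def B_def)
      ultimately have f: "f \<in> ell2 ?X" "ell2_norm ?X f \<le> 1"
        using ell2I_finite_sums[of ?X f 1] by simp_all
      obtain C where C: "0 \<le> C" "\<And>f. f \<in> ell2 ?X \<Longrightarrow> ell2_norm ?X (?P f) \<le> C * ell2_norm ?X f"
        using bounded_opsE[OF P] by blast
      have closed: "?P (chi ?B g) \<in> ell2 ?X" if "g \<in> ell2 ?X" for g
        by (intro bounded_ops_closed[OF P] chi_in_ell2 that)
      let ?h = "chi ?A (?P (chi ?B f))"
      have "ell2_norm ?X ?h \<le> op_norm ?X (\<lambda>f. chi ?A (?P (chi ?B f)))"
      proof (rule ell2_norm_le_op_norm[OF _ f, where B = C])
        fix g assume g: "g \<in> ell2 ?X" "ell2_norm ?X g \<le> 1"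
        have "ell2_norm ?X (chi ?A (?P (chi ?B g))) \<le> ell2_norm ?X (?P (chi ?B g))"
          by (intro ell2_norm_chi_le closed g)
        also have "\<dots> \<le> C * ell2_norm ?X (chi ?B g)" by (intro C chi_in_ell2 g)
        also have "\<dots> \<le> C * 1"
          using ell2_norm_chi_le[OF g(1), of ?B] g(2) C(1) by (intro mult_left_mono) auto
        finally show "ell2_norm ?X (chi ?A (?P (chi ?B g))) \<le> C" by simp
      qed
      then have "ell2_norm ?X ?h \<le> \<epsilon>" using \<open>op_norm ?X _ \<le> \<epsilon>\<close> by simp
      then have "(ell2_norm ?X ?h)\<^sup>2 \<le> \<epsilon>\<^sup>2" by (intro power_mono) auto
      also have "\<epsilon>\<^sup>2 = \<alpha> / 16" using \<alpha> by (simp add: \<epsilon>_def power_divide)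
      finally have up: "(ell2_norm ?X ?h)\<^sup>2 \<le> \<alpha> / 16" .
      have hval: "?h (n, x) = complex_of_real (sqrt (card B) / m)" if "x \<in> A" for x
      proof -
        have chif: "chi ?B f = f" by (auto simp: chi_def f_def)
        have "(\<Sum>y\<in>M n. f (n, y)) = (\<Sum>y\<in>B. complex_of_real (1 / sqrt (card B)))"
          using fin by (intro sum.mono_neutral_cong_right) (auto simp: f_def B_def)
        also have "\<dots> = complex_of_real (card B / sqrt (card B))" by simp
        also have "card B / sqrt (card B) = sqrt (card B)" by (simp add: real_div_sqrt)
        finally show ?thesis
          using that A f(1) by (auto simp: chi_def[of ?A] chif averaging_projection_def m_def)
      qed
      have "\<alpha> / 4 = (\<alpha> * m) * (m / 4) / m\<^sup>2" using m by (simp add: power2_eq_square)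
      also have "\<dots> \<le> card A * card B / m\<^sup>2"
        using mult_mono[OF A(2) cB] m by (intro divide_right_mono) (auto simp: m_def)
      also have "\<dots> = (\<Sum>x\<in>A. (cmod (?h (n, x)))\<^sup>2)"
        by (simp add: hval norm_divide power_divide m_def)
      also have "\<dots> = (\<Sum>z\<in>?A. (cmod (?h z))\<^sup>2)"
        by (intro sum.reindex_bij_witness[of _ snd "Pair n"]) auto
      also have "\<dots> \<le> (ell2_norm ?X ?h)\<^sup>2"
        using A finA f closed by (intro sum_le_ell2_norm_square chi_in_ell2) auto
      finally show False using up \<alpha> by simp
    qed
    then show ?thesis using R by - (rule exI[of _ "1/2"], rule exI[of _ R], simp)
  qed
  then show ?thesis using metric fin lim by (simp add: asymptotic_expanders_def)
qed

theorem theoremC: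
  fixes M :: "nat \<Rightarrow> 'a set"
    and d :: "nat \<Rightarrow> 'a \<Rightarrow> 'a \<Rightarrow> real"
    and D :: "nat \<times> 'a \<Rightarrow> nat \<times> 'a \<Rightarrow> real"
  assumes "\<And>n. Metric_space (M n) (d n)"
    and "\<And>n. finite (M n)"
    and "\<And>n. M n \<noteq> {}"
    and "uniformly_bounded_geometry M d"
    and "filterlim (\<lambda>n. card (M n)) at_top sequentially"
    and "coarse_disjoint_union M d D"
  shows "(averaging_projection M \<in> uniform_Roe_algebra (Sigma UNIV M) D
            \<longleftrightarrow> averaging_projection M \<in> uniform_quasi_local_algebra (Sigma UNIV M) D)
       \<and> (averaging_projection M \<in> uniform_quasi_local_algebra (Sigma UNIV M) D
            \<longleftrightarrow> asymptotic_expanders M d)"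
proof -
  have "averaging_projection M \<in> uniform_quasi_local_algebra (Sigma UNIV M) D \<Longrightarrow> asymptotic_expanders M d"
    using asymptotic_expanders_of_quasi_local[OF assms(1-3,5,6)]
    by (simp add: uniform_quasi_local_algebra_def)
  moreover have "asymptotic_expanders M d \<Longrightarrow> averaging_projection M \<in> uniform_Roe_algebra (Sigma UNIV M) D"
    by (rule averaging_projection_in_uniform_Roe_algebra[OF assms(1-4,6)])
  ultimately show ?thesis
    using uniform_Roe_subset_quasi_local[of "Sigma UNIV M" D] by blast
qed

end
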